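(* Let $a<b$, let each of $p_1,p_2,q$ be an integer or $\infty$, and suppose $r=\min\{p_1,p_2,q\}>1$. Let $k(t,s)$ be a $(p_1,p_2)$-semismooth kernel on $[a,b]\times[a,b]$ with associated $k_1\in C^{p_1}([a,b]\times[a,b])$ and $k_2\in C^{p_2}([a,b]\times[a,b])$, and let $y\in C^{q}([a,b])$. Suppose that the equation $$x(t)+\int_a^t k_1(t,s)x(s)\,ds+\int_t^b k_2(t,s)x(s)\,ds=y(t),\qquad a\le t\le b,$$ defines an invertible operator on $C^{r}([a,b])$ (i.e. the operator taking $x$ to the left-hand side is invertible on $C^r([a,b])$), and let $x$ be its solution. For each $n$ let $\mathbf M_n=\mathbf I+\frac{b-a}{2}(\mathbf W\circ\mathbf K_1+\mathbf V\circ\mathbf K_2)$, $\hat{\mathbf x}=(x(\eta_0),\dots,x(\eta_n))^T$ and $\bar{\mathbf y}=(y(\eta_0),\dots,y(\eta_n))^T$. Then for all sufficiently large $n$ the matrices $\mathbf M_n$ are invertible and their inverses are uniformly bounded (in the operator norm induced by $\|\cdot\|_\infty$). Consequently, for the solution $\bar{\mathbf x}$ of $\mathbf M_n\bar{\mathbf x}=\bar{\mathbf y}$: if $r<\infty$, then $\|\hat{\mathbf x}-\bar{\mathbf x}\|_\infty=O(n^{1-r})$ as $n\to\infty$; and if $p_1=p_2=q=\infty$, the convergence is superalgebraic, i.e. $\|\hat{\mathbf x}-\bar{\mathbf x}\|_\infty=O(n^{-N})$ for every $N\in\mathbb N$.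
   Context: Semismooth kernel: $k(t,s)$ is called $(p_1,p_2)$-semismooth (with $p_1,p_2>1$) if $k(t,s)=k_1(t,s)$ for $a\le s\le t$ and $k(t,s)=k_2(t,s)$ for $t\le s\le b$, where $k_1\in C^{p_1}$ and $k_2\in C^{p_2}$ are both defined on the whole square $[a,b]\times[a,b]$. Discretization, for given $n$ (all matrices below are $(n+1)\times(n+1)$ with rows and columns indexed $0,\dots,n$, and depend on $n$): $T_j(s)=\cos(j\arccos s)$ are the Chebyshev polynomials; $\tau_k=\cos\frac{(2k+1)\pi}{2(n+1)}$, $k=0,\dots,n$, are the zeros of $T_{n+1}$; $\eta_k=\frac{b-a}{2}\tau_k+\frac{a+b}{2}$. $\mathbf C$ is the matrix with entries $\mathbf C_{kj}=T_j(\tau_k)$. Let $\mathbf B$ be the matrix whose row $0$ is zero, whose row $1$ has entries $\mathbf B_{1,0}=1$, $\mathbf B_{1,2}=-\frac12$, whose row $j$ for $2\le j\le n$ has entries $\mathbf B_{j,j-1}=\frac1{2j}$ and (if $j+1\le n$) $\mathbf B_{j,j+1}=-\frac1{2j}$, and all other entries zero. The left spectral integration matrix is $\mathbf S_L=\mathbf P_L\mathbf B$, where $\mathbf P_L$ has row $0$ equal to $(1,1,-1,1,\dots,(-1)^{n+1})$ (entry $(-1)^{j+1}$ in column $j\ge1$) and its rows $1,\dots,n$ are those of the identity matrix. The right spectral integration matrix is $\mathbf S_R=\mathbf P_R\mathbf B$, where $\mathbf P_R$ has row $0$ equal to $(1,1,\dots,1)$ and its rows $1,\dots,n$ are those of minus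 the identity matrix. Set $\mathbf W=\mathbf C\mathbf S_L\mathbf C^{-1}$, $\mathbf V=\mathbf C\mathbf S_R\mathbf C^{-1}$, $\mathbf K_1=(k_1(\eta_i,\eta_j))_{i,j=0}^n$, $\mathbf K_2=(k_2(\eta_i,\eta_j))_{i,j=0}^n$. The symbol $\circ$ denotes the Schur (entrywise) product, $\mathbf I$ the identity matrix, and $\|\cdot\|_\infty$ the maximum norm on $\mathbb R^{n+1}$. Constants implied in $O(\cdot)$ are independent of $n$. *)

theory Defs
  imports
    "HOL-Analysis.Analysis"
    "HOL-Library.Extended_Nat"
    "HOL-Library.FuncSet"
    "HOL-Library.Landau_Symbols"
    "Jordan_Normal_Form.Matrix"
    "Jordan_Normal_Form.Gauss_Jordan_Elimination"
begin

section \<open>Functions of class $C^p$ on an interval or a square\<close>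

text \<open>Derivatives are taken within \<open>S\<close>, i.e. one-sided at boundary points. They are unique
  for the sets used here, which are convex with nonempty interior. The basis of \<^typ>\<open>real\<close> is
  \<open>{1}\<close> and that of \<^typ>\<open>real \<times> real\<close> is \<open>{(1,0), (0,1)}\<close>, so that \<open>\<lambda>x. f' x b\<close>
  ranges over the first-order partial derivatives.\<close>

primrec Cn_on :: "nat \<Rightarrow> 'a::euclidean_space set \<Rightarrow> ('a \<Rightarrow> real) \<Rightarrow> bool" where
  "Cn_on 0 S f \<longleftrightarrow> continuous_on S f"
| "Cn_on (Suc m) S f \<longleftrightarrow>
     (\<exists>f'. (\<forall>x\<in>S. (f has_derivative f' x) (at x within S)) \<and>
           (\<forall>b\<in>Basis. Cn_on m S (\<lambda>x. f' x b)))"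

definition C_on :: "enat \<Rightarrow> 'a::euclidean_space set \<Rightarrow> ('a \<Rightarrow> real) \<Rightarrow> bool" where
  "C_on p S f \<longleftrightarrow> (\<forall>m. enat m \<le> p \<longrightarrow> Cn_on m S f)"

text \<open>The space $C^p([a,b])$; restricting to extensional functions identifies functions that
  agree on $[a,b]$.\<close>

definition C_space :: "enat \<Rightarrow> real \<Rightarrow> real \<Rightarrow> (real \<Rightarrow> real) set" where
  "C_space p a b = {f \<in> extensional {a..b}. C_on p {a..b} f}"

section \<open>The integral equation\<close>

definition semismooth ::
  "enat \<Rightarrow> enat \<Rightarrow> real \<Rightarrow> real \<Rightarrow> (real \<Rightarrow> real \<Rightarrow> real) \<Rightarrow>
   (real \<Rightarrow> real \<Rightarrow> real) \<Rightarrow> (real \<Rightarrow> real \<Rightarrow> real) \<Rightarrow> bool" where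
  "semismooth p1 p2 a b k k1 k2 \<longleftrightarrow>
     p1 > 1 \<and> p2 > 1 \<and>
     C_on p1 ({a..b} \<times> {a..b}) (\<lambda>(t, s). k1 t s) \<and>
     C_on p2 ({a..b} \<times> {a..b}) (\<lambda>(t, s). k2 t s) \<and>
     (\<forall>t\<in>{a..b}. (\<forall>s\<in>{a..t}. k t s = k1 t s) \<and> (\<forall>s\<in>{t..b}. k t s = k2 t s))"

definition integral_op ::
  "real \<Rightarrow> real \<Rightarrow> (real \<Rightarrow> real \<Rightarrow> real) \<Rightarrow> (real \<Rightarrow> real \<Rightarrow> real) \<Rightarrow>
   (real \<Rightarrow> real) \<Rightarrow> real \<Rightarrow> real" where
  "integral_op a b k1 k2 x t =
     x t + integral {a..t} (\<lambda>s. k1 t s * x s) + integral {t..b} (\<lambda>s. k2 t s * x s)"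

definition invertible_on_C ::
  "enat \<Rightarrow> real \<Rightarrow> real \<Rightarrow> ((real \<Rightarrow> real) \<Rightarrow> real \<Rightarrow> real) \<Rightarrow> bool" where
  "invertible_on_C p a b L \<longleftrightarrow>
     bij_betw (\<lambda>x. restrict (L x) {a..b}) (C_space p a b) (C_space p a b)"

section \<open>Matrices\<close>

text \<open>Only meaningful for invertible matrices.\<close>

definition mat_inv :: "real Matrix.mat \<Rightarrow> real Matrix.mat" where
  "mat_inv A = the (mat_inverse A)"

definition schur_prod :: "real Matrix.mat \<Rightarrow> real Matrix.mat \<Rightarrow> real Matrix.mat" where
  "schur_prod A B = Matrix.mat (dim_row A) (dim_col A) (\<lambda>(i, j). A $$ (i, j) * B $$ (i, j))"

definition max_norm :: "real Matrix.vec \<Rightarrow> real" where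
  "max_norm v = Max ((\<lambda>i. \<bar>vec_index v i\<bar>) ` {..<dim_vec v})"

definition op_norm :: "real Matrix.mat \<Rightarrow> real" where
  "op_norm A = (SUP v \<in> {v \<in> carrier_vec (dim_col A). max_norm v \<le> 1}. max_norm (A *\<^sub>v v))"

section \<open>The discretization\<close>

definition cheb :: "nat \<Rightarrow> real \<Rightarrow> real" where
  "cheb j s = cos (real j * arccos s)"

definition tau :: "nat \<Rightarrow> nat \<Rightarrow> real" where
  "tau n k = cos ((2 * real k + 1) * pi / (2 * (real n + 1)))"

definition eta :: "real \<Rightarrow> real \<Rightarrow> nat \<Rightarrow> nat \<Rightarrow> real" where
  "eta a b n k = (b - a) / 2 * tau n k + (a + b) / 2"

definition C_mat :: "nat \<Rightarrow> real Matrix.mat" where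
  "C_mat n = Matrix.mat (n + 1) (n + 1) (\<lambda>(k, j). cheb j (tau n k))"

definition B_mat :: "nat \<Rightarrow> real Matrix.mat" where
  "B_mat n = Matrix.mat (n + 1) (n + 1) (\<lambda>(i, j).
     if i = 0 then 0
     else if i = 1 then (if j = 0 then 1 else if j = 2 then - 1 / 2 else 0)
     else if j + 1 = i then 1 / (2 * real i)
     else if j = i + 1 then - 1 / (2 * real i)
     else 0)"

definition PL_mat :: "nat \<Rightarrow> real Matrix.mat" where
  "PL_mat n = Matrix.mat (n + 1) (n + 1) (\<lambda>(i, j).
     if i = 0 then (if j = 0 then 1 else (- 1) ^ (j + 1))
     else if i = j then 1 else 0)"

definition PR_mat :: "nat \<Rightarrow> real Matrix.mat" where
  "PR_mat n = Matrix.mat (n + 1) (n + 1) (\<lambda>(i, j).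
     if i = 0 then 1
     else if i = j then - 1 else 0)"

definition W_mat :: "nat \<Rightarrow> real Matrix.mat" where
  "W_mat n = C_mat n * (PL_mat n * B_mat n) * mat_inv (C_mat n)"

definition V_mat :: "nat \<Rightarrow> real Matrix.mat" where
  "V_mat n = C_mat n * (PR_mat n * B_mat n) * mat_inv (C_mat n)"

definition K_mat :: "real \<Rightarrow> real \<Rightarrow> (real \<Rightarrow> real \<Rightarrow> real) \<Rightarrow> nat \<Rightarrow> real Matrix.mat" where
  "K_mat a b k n = Matrix.mat (n + 1) (n + 1) (\<lambda>(i, j). k (eta a b n i) (eta a b n j))"

definition M_mat ::
  "real \<Rightarrow> real \<Rightarrow> (real \<Rightarrow> real \<Rightarrow> real) \<Rightarrow> (real \<Rightarrow> real \<Rightarrow> real) \<Rightarrow> nat \<Rightarrow> real Matrix.mat" where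
  "M_mat a b k1 k2 n = 1\<^sub>m (n + 1) + ((b - a) / 2) \<cdot>\<^sub>m
     (schur_prod (W_mat n) (K_mat a b k1 n) + schur_prod (V_mat n) (K_mat a b k2 n))"

definition sample :: "real \<Rightarrow> real \<Rightarrow> (real \<Rightarrow> real) \<Rightarrow> nat \<Rightarrow> real Matrix.vec" where
  "sample a b f n = Matrix.vec (n + 1) (\<lambda>i. f (eta a b n i))"

end

theory Submission
  imports Defs "HOL-Complex_Analysis.Great_Picard" "Jordan_Normal_Form.Determinant"
begin

text \<open>Substituting \<open>s = cos u\<close> turns polynomial interpolation at the Chebyshev points into
  cosine interpolation on \<open>{0..pi}\<close>. At the nodes, the rows of \<open>W\<close> and \<open>V\<close> integrate the
  interpolant exactly up to a constant of size \<open>O(1/n)\<close>, which comes from the truncated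
  coefficient. By discrete orthogonality the interpolant is bounded in the mean square by the
  maximum of the data, so these quadratures are uniformly bounded and Hoelder-1/2 in the endpoint.
  Hence the discrete operators are collectively compact and converge pointwise, and Arzela-Ascoli
  yields a uniform bound for the inverses once the integral operator is injective on continuous
  functions. Injectivity on \<open>C\<^sup>r\<close> suffices because a continuous null function is as smooth as the
  kernels. For smooth data the Chebyshev coefficients decay like \<open>j\<^sup>-\<^sup>r\<close>, so best approximation,
  and with it the consistency error, is \<open>O(n\<^sup>1\<^sup>-\<^sup>r)\<close>.\<close>

section \<open>Discrete cosine interpolation and its integral\<close>

text \<open>Interpolation at Chebyshev points is not uniformly bounded in the maximum norm: its
  Lebesgue constant grows like log n. Hence all estimates concern integrals of the interpolant,
  never its pointwise values; integration over a length d of a function with bounded mean square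
  costs only sqrt d. The semismooth kernel has a kink on the diagonal, which would spoil any
  approximation in s. It never enters: for fixed t, each of \<open>k1\<close> and \<open>k2\<close>
  is smooth across all of [a, b], is interpolated there, and only then integrated up to t or from t
  on. Vectors of different lengths cannot be compared, so each discrete operator is extended to a
  function on all of [0, pi] by leaving the endpoint t free. The compactness argument takes place
  among these functions. Stability is stated as a bound of an array by its residual. This one
  inequality yields invertibility, the bound of the inverses and the error estimate.\<close>

definition node :: "nat \<Rightarrow> nat \<Rightarrow> real" where
  "node n k = (2 * real k + 1) * pi / (2 * (real n + 1))"

text \<open>The discrete cosine transform: the coefficients in cos 0, cos t, ..., cos (n t) of the
  polynomial interpolating \<open>g\<close> at the nodes. They are the rows of
  \<open>mat_inv (C_mat n)\<close> applied to \<open>g\<close>.\<close>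

definition coef :: "nat \<Rightarrow> (nat \<Rightarrow> real) \<Rightarrow> nat \<Rightarrow> real" where
  "coef n g l = (if l = 0 then 1 else 2) / (real n + 1) * (\<Sum>k\<le>n. g k * cos (real l * node n k))"

text \<open>An antiderivative of \<open>- cos (l t) sin t\<close>; for \<open>l = 1\<close> the second quotient is \<open>x / 0 = 0\<close>,
  as it should be.\<close>

definition anti :: "nat \<Rightarrow> real \<Rightarrow> real" where
  "anti l t = cos ((real l + 1) * t) / (2 * (real l + 1)) - cos ((real l - 1) * t) / (2 * (real l - 1))"

text \<open>The integral from \<open>t\<close> to \<open>\<alpha>\<close> of the interpolant against \<open>sin\<close>, as computed by the truncated
  matrix \<open>B\<close>: the last summand is the contribution of the dropped \<open>cos (n + 1)\<close> at \<open>\<alpha>\<close>, which does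
  not vanish there as it does at the nodes.\<close>

definition quad :: "nat \<Rightarrow> real \<Rightarrow> real \<Rightarrow> (nat \<Rightarrow> real) \<Rightarrow> real" where
  "quad n \<alpha> t g = (\<Sum>l\<le>n. coef n g l * (anti l t - anti l \<alpha>))
     + coef n g n * cos ((real n + 1) * \<alpha>) / (2 * (real n + 1))"

section \<open>Discrete orthogonality of the cosines at the nodes\<close>

lemma node_bounds: "k \<le> n \<Longrightarrow> 0 < node n k \<and> node n k < pi"
proof -
  assume "k \<le> n"
  then have "(2 * real k + 1) * pi < (2 * (real n + 1)) * pi" "0 < (2 * real k + 1) * pi"
    by (auto intro!: mult_strict_right_mono mult_pos_pos)
  then show ?thesis
    by (simp add: node_def pos_divide_less_eq mult.commute)
qed

lemma cos_node_last: "cos ((real n + 1) * node n k) = 0"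
proof -
  have "(real n + 1) * node n k = of_int (2 * int k + 1) * (pi / 2)"
    unfolding node_def by (simp add: field_simps add_nonneg_eq_0_iff)
  moreover have "odd (2 * int k + 1)" by simp
  ultimately show ?thesis unfolding cos_zero_iff_int by blast
qed

text \<open>Multiplication by \<open>2 * sin \<beta>\<close>, with \<beta> half the step of the
  angles \<open>m * node n k\<close>, makes the sum telescope to \<open>sin (m * pi) = 0\<close>.
  The bound on \<open>m\<close> keeps \<beta> below pi; at \<open>m = 2 * (n + 1)\<close> every
  cosine equals -1 and aliasing sets in.\<close>

lemma sum_cos_node:
  assumes "m < 2 * (n + 1)"
  shows "(\<Sum>k\<le>n. cos (real m * node n k)) = (if m = 0 then real n + 1 else 0)"
proof (cases "m = 0")
  case False
  define \<beta> where "\<beta> = real m * pi / (2 * (real n + 1))"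
  have "real m < real (2 * (n + 1))" using assms by (simp only: of_nat_less_iff)
  then have "real m < 2 * (real n + 1)" by simp
  then have "0 < \<beta>" "\<beta> < pi" using False by (auto simp: \<beta>_def pos_divide_less_eq mult.commute)
  then have s: "sin \<beta> > 0" by (rule sin_gt_zero)
  have "real m * node n k = (2 * real k + 1) * \<beta>" for k
    by (simp add: node_def \<beta>_def)
  then have "2 * sin \<beta> * cos (real m * node n k) = sin (2 * real (Suc k) * \<beta>) - sin (2 * real k * \<beta>)" for k
    by (subst sin_diff_sin) (simp add: algebra_simps diff_divide_distrib add_divide_distrib)
  then have "2 * sin \<beta> * (\<Sum>k\<le>n. cos (real m * node n k)) = (\<Sum>k<Suc n. sin (2 * real (Suc k) * \<beta>) - sin (2 * real k * \<beta>))"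
    by (simp only: sum_distrib_left lessThan_Suc_atMost)
  also have "\<dots> = sin (2 * real (Suc n) * \<beta>)"
    by (subst sum_lessThan_telescope) simp
  also have "2 * real (Suc n) * \<beta> = real m * pi"
    by (simp add: \<beta>_def field_simps)
  also have "sin (real m * pi) = 0" by simp
  finally show ?thesis using s False by simp
qed simp

text \<open>The absolute difference keeps both frequencies natural numbers, the form in which
  \<open>sum_cos_node\<close> and \<open>cos_polys\<close> take them.\<close>

lemma cos_cos_nat:
  "cos (real i * t) * cos (real j * t)
     = (cos (real (nat \<bar>int i - int j\<bar>) * t) + cos (real (i + j) * t)) / 2"
proof -
  have "cos (real (nat \<bar>int i - int j\<bar>) * t) = cos (real i * t - real j * t)"
  proof (cases "i \<le> j")
    case True
    then have "real (nat \<bar>int i - int j\<bar>) * t = - (real i * t - real j * t)"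
      by (simp add: algebra_simps)
    then show ?thesis by (simp only: cos_minus)
  qed (simp add: algebra_simps)
  then show ?thesis by (simp add: cos_times_cos algebra_simps)
qed

text \<open>The sum frequency i + j <= 2 n stays below the aliasing threshold 2 (n + 1).\<close>

lemma sum_cos_cos_node:
  assumes "i \<le> n" "j \<le> n"
  shows "(\<Sum>k\<le>n. cos (real i * node n k) * cos (real j * node n k)) =
     (if i = j then (if i = 0 then real n + 1 else (real n + 1) / 2) else 0)"
proof -
  have "(\<Sum>k\<le>n. cos (real i * node n k) * cos (real j * node n k))
     = ((\<Sum>k\<le>n. cos (real (nat \<bar>int i - int j\<bar>) * node n k)) + (\<Sum>k\<le>n. cos (real (i + j) * node n k))) / 2"
    by (simp only: cos_cos_nat sum_divide_distrib[symmetric] sum.distrib)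
  then show ?thesis using assms by (subst (asm) (1 2) sum_cos_node) auto
qed

lemma coef_cos:
  assumes "i \<le> n" "l \<le> n"
  shows "coef n (\<lambda>k. cos (real i * node n k)) l = (if i = l then 1 else 0)"
  using sum_cos_cos_node[OF assms] by (auto simp: coef_def)

lemma coef_add: "coef n (\<lambda>k. f k + g k) l = coef n f l + coef n g l"
  by (simp add: coef_def sum.distrib algebra_simps)

lemma coef_cmult: "coef n (\<lambda>k. c * f k) l = c * coef n f l"
  by (simp add: coef_def sum_distrib_left algebra_simps)

lemma coef_sum: "coef n (\<lambda>k. \<Sum>i\<in>A. f i k) l = (\<Sum>i\<in>A. coef n (f i) l)"
proof (induction A rule: infinite_finite_induct)
  case (insert x F)
  then show ?case by (simp add: coef_add)
qed (auto simp: coef_def)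

lemma quad_add: "quad n \<alpha> t (\<lambda>k. f k + g k) = quad n \<alpha> t f + quad n \<alpha> t g"
  unfolding quad_def coef_add
  by (simp add: sum.distrib distrib_right add_divide_distrib)

lemma quad_cmult: "quad n \<alpha> t (\<lambda>k. c * f k) = c * quad n \<alpha> t f"
  by (simp add: quad_def coef_cmult sum_distrib_left algebra_simps)

lemma quad_diff: "quad n \<alpha> t (\<lambda>k. f k - g k) = quad n \<alpha> t f - quad n \<alpha> t g"
  using quad_add[of n \<alpha> t f "\<lambda>k. (-1) * g k"] quad_cmult[of n \<alpha> t "-1" g] by simp

text \<open>With \<open>p\<close> the interpolating polynomial at the nodes, orthogonality gives <g,
  p> = <p, p>, and the inequality is the expansion of 0 <= |g - p|^2. The weight 2 at
  \<open>l = 0\<close> is the one of \<open>has_integral_cos_sum_sq\<close>, so that the left side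
  times pi / 2 is the integral of the squared polynomial.\<close>

lemma Bessel_node:
  "(\<Sum>l\<le>n. (coef n g l)\<^sup>2 * (if l = 0 then 2 else 1)) \<le> 2 / (real n + 1) * (\<Sum>k\<le>n. (g k)\<^sup>2)"
proof -
  define c where "c = coef n g"
  define w where "w l = (if l = 0 then real n + 1 else (real n + 1) / 2)" for l :: nat
  have w: "w l * c l = (\<Sum>k\<le>n. g k * cos (real l * node n k))" for l
    by (simp add: c_def coef_def w_def)
  define p where "p k = (\<Sum>l\<le>n. c l * cos (real l * node n k))" for k
  have gp: "(\<Sum>k\<le>n. g k * p k) = (\<Sum>l\<le>n. w l * (c l)\<^sup>2)"
  proof -
    have "(\<Sum>k\<le>n. g k * p k) = (\<Sum>l\<le>n. \<Sum>k\<le>n. c l * (g k * cos (real l * node n k)))"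
      unfolding p_def sum_distrib_left by (subst sum.swap) (simp add: algebra_simps)
    also have "\<dots> = (\<Sum>l\<le>n. c l * (w l * c l))"
      by (simp only: w sum_distrib_left)
    finally show ?thesis by (simp add: power2_eq_square algebra_simps)
  qed
  have pp: "(\<Sum>k\<le>n. p k * p k) = (\<Sum>l\<le>n. w l * (c l)\<^sup>2)"
  proof -
    have "(\<Sum>k\<le>n. p k * p k) = (\<Sum>k\<le>n. \<Sum>i\<le>n. \<Sum>j\<le>n. c i * c j * (cos (real i * node n k) * cos (real j * node n k)))"
      unfolding p_def sum_product by (simp add: algebra_simps)
    also have "\<dots> = (\<Sum>i\<le>n. \<Sum>j\<le>n. \<Sum>k\<le>n. c i * c j * (cos (real i * node n k) * cos (real j * node n k)))"
      by (rule trans[OF sum.swap sum.cong[OF refl sum.swap]])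
    also have "\<dots> = (\<Sum>i\<le>n. \<Sum>j\<le>n. c i * c j * (if i = j then w i else 0))"
      by (intro sum.cong refl) (auto simp only: sum_distrib_left[symmetric] sum_cos_cos_node w_def atMost_iff)
    also have "\<dots> = (\<Sum>i\<le>n. c i * c i * w i)"
      by (intro sum.cong refl) (simp add: if_distrib[of "\<lambda>x. _ * x"] sum.delta cong: if_cong)
    finally show ?thesis by (simp add: power2_eq_square algebra_simps)
  qed
  have "0 \<le> (\<Sum>k\<le>n. (g k - p k)\<^sup>2)" by (simp add: sum_nonneg)
  also have "\<dots> = (\<Sum>k\<le>n. (g k)\<^sup>2) - 2 * (\<Sum>k\<le>n. g k * p k) + (\<Sum>k\<le>n. p k * p k)"
    by (simp add: power2_eq_square algebra_simps sum.distrib sum_subtractf sum_distrib_left)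
  finally have "(\<Sum>l\<le>n. w l * (c l)\<^sup>2) \<le> (\<Sum>k\<le>n. (g k)\<^sup>2)"
    using gp pp by simp
  moreover have "(\<Sum>l\<le>n. (c l)\<^sup>2 * (if l = 0 then 2 else 1)) = 2 / (real n + 1) * (\<Sum>l\<le>n. w l * (c l)\<^sup>2)"
    unfolding sum_distrib_left by (intro sum.cong refl) (auto simp: w_def)
  ultimately show ?thesis
    unfolding c_def[symmetric] by (simp add: divide_right_mono mult_left_mono)
qed

section \<open>Mean-square control of the interpolant and uniform bounds for the quadrature\<close>

lemma has_integral_cos_cos:
  "((\<lambda>t. cos (real i * t) * cos (real j * t)) has_integral
      (if i = j then (if i = 0 then pi else pi / 2) else 0)) {0..pi}"
proof -
  have *: "((\<lambda>t. cos (real_of_int m * t)) has_integral (if m = 0 then pi else 0)) {0..pi}" for m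
  proof (cases "m = 0")
    case True
    then show ?thesis using has_integral_const_real[of "1::real" 0 pi] by simp
  next
    case False
    have "((\<lambda>t. cos (real_of_int m * t)) has_integral (sin (real_of_int m * pi) / m - sin (real_of_int m * 0) / m)) {0..pi}"
      by (rule fundamental_theorem_of_calculus)
        (use False in \<open>auto intro!: derivative_eq_intros simp: has_real_derivative_iff_has_vector_derivative[symmetric]\<close>)
    then show ?thesis using False by (simp add: sin_int_times_real mult.commute)
  qed
  have "((\<lambda>t. (cos (real_of_int (int i - int j) * t) + cos (real_of_int (int i + int j) * t)) / 2) has_integral
     ((if int i - int j = 0 then pi else 0) + (if int i + int j = 0 then pi else 0)) / 2) {0..pi}"
    by (intro has_integral_divide has_integral_add *)
  moreover have "(cos (real_of_int (int i - int j) * t) + cos (real_of_int (int i + int j) * t)) / 2 = cos (real i * t) * cos (real j * t)" for t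
    by (simp add: cos_times_cos algebra_simps)
  moreover have "((if int i - int j = 0 then pi else 0) + (if int i + int j = 0 then pi else 0)) / 2 = (if i = j then (if i = 0 then pi else pi / 2) else 0)"
    by auto
  ultimately show ?thesis by (simp only:)
qed

lemma has_integral_cos_sum_sq:
  "((\<lambda>t. (\<Sum>l\<le>n. c l * cos (real l * t))\<^sup>2) has_integral
      pi / 2 * (\<Sum>l\<le>n. (c l)\<^sup>2 * (if l = 0 then 2 else 1))) {0..pi}"
proof -
  have "((\<lambda>t. \<Sum>i\<le>n. \<Sum>j\<le>n. c i * c j * (cos (real i * t) * cos (real j * t))) has_integral
      (\<Sum>i\<le>n. \<Sum>j\<le>n. c i * c j * (if i = j then (if i = 0 then pi else pi / 2) else 0))) {0..pi}"
    by (intro has_integral_sum finite_atMost has_integral_mult_right has_integral_cos_cos)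
  moreover have "(\<Sum>i\<le>n. \<Sum>j\<le>n. c i * c j * (cos (real i * t) * cos (real j * t))) = (\<Sum>l\<le>n. c l * cos (real l * t))\<^sup>2" for t
    unfolding power2_eq_square sum_product by (simp add: algebra_simps)
  moreover have "(\<Sum>i\<le>n. \<Sum>j\<le>n. c i * c j * (if i = j then (if i = 0 then pi else pi / 2) else 0))
     = pi / 2 * (\<Sum>l\<le>n. (c l)\<^sup>2 * (if l = 0 then 2 else 1))"
    unfolding sum_distrib_left
    by (intro sum.cong refl) (auto simp add: if_distrib[of "\<lambda>x. _ * x"] sum.delta power2_eq_square cong: if_cong)
  ultimately show ?thesis by (simp only:)
qed

lemma anti_has_derivative:
  "(anti l has_real_derivative - (cos (real l * t) * sin t)) (at t within S)"
proof -
  \<comment> \<open>The case \<open>c = 0\<close> occurs for \<open>l = 1\<close>: the quotient is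
    constantly 0 by division by zero, and so is \<open>sin (0 * t)\<close>.\<close>
  have *: "((\<lambda>t. cos (c * t) / (2 * c)) has_real_derivative - sin (c * t) / 2) (at t within S)" for c :: real
    by (cases "c = 0") (auto intro!: derivative_eq_intros)
  have "((\<lambda>t. cos ((real l + 1) * t) / (2 * (real l + 1)) - cos ((real l - 1) * t) / (2 * (real l - 1)))
     has_real_derivative - sin ((real l + 1) * t) / 2 - - sin ((real l - 1) * t) / 2) (at t within S)"
    by (intro DERIV_diff *)
  moreover have "- sin ((real l + 1) * t) / 2 - - sin ((real l - 1) * t) / 2 = - (cos (real l * t) * sin t)"
    by (simp add: distrib_right left_diff_distrib sin_add sin_diff) (simp add: field_simps)
  ultimately show ?thesis
    unfolding anti_def[abs_def] by (simp only:)
qed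

lemma anti_sum_integral:
  assumes "s \<le> t"
  shows "((\<lambda>u. (\<Sum>l\<in>A. c l * cos (real l * u)) * sin u) has_integral (\<Sum>l\<in>A. c l * (anti l s - anti l t))) {s..t}"
proof -
  have "((\<lambda>u. \<Sum>l\<in>A. - c l * anti l u) has_real_derivative (\<Sum>l\<in>A. c l * cos (real l * u)) * sin u) (at u within {s..t})" for u
    by (auto intro!: derivative_eq_intros anti_has_derivative[THEN DERIV_chain2] simp: sum_distrib_right sum_distrib_left mult_ac)
  then have "((\<lambda>u. (\<Sum>l\<in>A. c l * cos (real l * u)) * sin u) has_integral (\<Sum>l\<in>A. - c l * anti l t) - (\<Sum>l\<in>A. - c l * anti l s)) {s..t}"
    by (intro fundamental_theorem_of_calculus) (auto simp: assms has_real_derivative_iff_has_vector_derivative[symmetric])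
  moreover have "(\<Sum>l\<in>A. - c l * anti l t) - (\<Sum>l\<in>A. - c l * anti l s) = (\<Sum>l\<in>A. c l * (anti l s - anti l t))"
    unfolding sum_subtractf[symmetric] by (intro sum.cong refl) (simp add: algebra_simps)
  ultimately show ?thesis by (simp only:)
qed

text \<open>The interpolating cosine polynomial is bounded in the mean square by the data, so its
  integral over an interval of length \<open>\<delta>\<close> is of order \<open>sqrt \<delta>\<close>, uniformly in \<open>n\<close>.\<close>

lemma quad_diff_bound:
  assumes g: "\<And>k. k \<le> n \<Longrightarrow> \<bar>g k\<bar> \<le> B" and st: "0 \<le> s" "s \<le> t" "t \<le> pi" and "0 < \<delta>" "t - s \<le> \<delta>\<^sup>2"
  shows "\<bar>quad n \<alpha> s g - quad n \<alpha> t g\<bar> \<le> 4 * B * \<delta>"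
proof -
  define c where "c = coef n g"
  define p where "p u = (\<Sum>l\<le>n. c l * cos (real l * u))" for u
  have B: "0 \<le> B" using g[of 0] by linarith
  have cont: "continuous_on S p" for S
    unfolding p_def by (intro continuous_intros)
  have "(\<Sum>k\<le>n. (g k)\<^sup>2) \<le> (\<Sum>k\<le>n. B\<^sup>2)"
    using g by (intro sum_mono) (metis abs_ge_zero atMost_iff power2_abs power_mono)
  then have "2 / (real n + 1) * (\<Sum>k\<le>n. (g k)\<^sup>2) \<le> 2 / (real n + 1) * ((real n + 1) * B\<^sup>2)"
    by (intro mult_left_mono) (auto simp: add.commute)
  also have "\<dots> = 2 * B\<^sup>2" by (simp add: field_simps)
  finally have *: "(\<Sum>l\<le>n. (c l)\<^sup>2 * (if l = 0 then 2 else 1)) \<le> 2 * B\<^sup>2"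
    unfolding c_def using Bessel_node[of n g] by linarith
  have p2: "(\<lambda>u. (p u)\<^sup>2) integrable_on {0..pi}"
    by (intro integrable_continuous_real continuous_intros cont)
  have "integral {s..t} (\<lambda>u. (p u)\<^sup>2) \<le> integral {0..pi} (\<lambda>u. (p u)\<^sup>2)"
    by (intro integral_subset_le p2 integrable_continuous_real continuous_intros cont) (use st in auto)
  also have "\<dots> = pi / 2 * (\<Sum>l\<le>n. (c l)\<^sup>2 * (if l = 0 then 2 else 1))"
    unfolding p_def using has_integral_cos_sum_sq by (rule integral_unique)
  also have "\<dots> \<le> pi / 2 * (2 * B\<^sup>2)" by (intro mult_left_mono *) simp
  also have "\<dots> \<le> 4 * B\<^sup>2" using pi_less_4 by (simp add: mult_right_mono)
  finally have I: "integral {s..t} (\<lambda>u. (p u)\<^sup>2) \<le> 4 * B\<^sup>2" .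
  \<comment> \<open>The terms depending on \<alpha> alone cancel; what remains is the exact integral
    of the interpolant.\<close>
  have "quad n \<alpha> s g - quad n \<alpha> t g = (\<Sum>l\<le>n. c l * (anti l s - anti l t))"
    by (simp add: quad_def c_def sum_subtractf[symmetric] algebra_simps)
  also have "\<dots> = integral {s..t} (\<lambda>u. p u * sin u)"
    unfolding p_def by (rule integral_unique[symmetric], rule anti_sum_integral, rule st)
  finally have Q: "\<bar>quad n \<alpha> s g - quad n \<alpha> t g\<bar> = norm (integral {s..t} (\<lambda>u. p u * sin u))"
    by simp
  show ?thesis
  \<comment> \<open>The weighted inequality used below divides by \<open>B\<close>, so vanishing
    data are split off.\<close>
  proof (cases "B = 0")
    case True
    then have "coef n g l = 0" for l using g by (auto simp: coef_def)
    then show ?thesis using True by (simp add: quad_def)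
  next
    case False
    with B have B: "0 < B" by simp
    \<comment> \<open>Cauchy-Schwarz in the form |p| <= B / \<delta> + \<delta> p^2 / (4 B), which
      is (2 B / \<delta> - |p|)^2 >= 0. The weights balance: over a length \<delta>^2, and with p^2
      integrating to at most 4 B^2, each term contributes at most B \<delta>.\<close>
    have "norm (integral {s..t} (\<lambda>u. p u * sin u)) \<le> integral {s..t} (\<lambda>u. B / \<delta> + \<delta> / (4 * B) * (p u)\<^sup>2)"
    proof (rule integral_norm_bound_integral)
      fix u
      have "0 \<le> (2 * B / \<delta> - \<bar>p u\<bar>)\<^sup>2 * \<delta> / (4 * B)" using B \<open>0 < \<delta>\<close> by simp
      also have "\<dots> = B / \<delta> + \<delta> / (4 * B) * (p u)\<^sup>2 - \<bar>p u\<bar>"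
        using B \<open>0 < \<delta>\<close> by (simp add: field_simps power2_eq_square)
      finally have "\<bar>p u\<bar> \<le> B / \<delta> + \<delta> / (4 * B) * (p u)\<^sup>2" by simp
      moreover have "\<bar>p u * sin u\<bar> \<le> \<bar>p u\<bar> * 1" unfolding abs_mult by (intro mult_left_mono) auto
      ultimately show "norm (p u * sin u) \<le> B / \<delta> + \<delta> / (4 * B) * (p u)\<^sup>2" by simp
    qed (intro integrable_continuous_real continuous_intros cont)+
    also have "\<dots> = (t - s) * (B / \<delta>) + \<delta> / (4 * B) * integral {s..t} (\<lambda>u. (p u)\<^sup>2)"
    proof -
      have "(\<lambda>u. \<delta> / (4 * B) * (p u)\<^sup>2) integrable_on {s..t}"
        by (intro integrable_continuous_real continuous_intros cont)
      then show ?thesis by (subst Henstock_Kurzweil_Integration.integral_add) (use st in \<open>auto simp: integrable_continuous_real\<close>)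
    qed
    also have "\<dots> \<le> \<delta>\<^sup>2 * (B / \<delta>) + \<delta> / (4 * B) * (4 * B\<^sup>2)"
      using B \<open>0 < \<delta>\<close> I \<open>t - s \<le> \<delta>\<^sup>2\<close> by (intro add_mono mult_left_mono mult_right_mono) auto
    also have "\<dots> \<le> 4 * B * \<delta>" using B \<open>0 < \<delta>\<close> by (simp add: power2_eq_square field_simps)
    finally show ?thesis using Q by simp
  qed
qed

lemma coef_bound:
  assumes "\<And>k. k \<le> n \<Longrightarrow> \<bar>g k\<bar> \<le> B"
  shows "\<bar>coef n g l\<bar> \<le> 2 * B"
proof -
  have B: "0 \<le> B" using assms[of 0] by linarith
  have "\<bar>\<Sum>k\<le>n. g k * cos (real l * node n k)\<bar> \<le> (\<Sum>k\<le>n. \<bar>g k * cos (real l * node n k)\<bar>)"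
    by (rule sum_abs)
  also have "\<dots> \<le> (\<Sum>k\<le>n. B * 1)"
    unfolding abs_mult by (intro sum_mono mult_mono) (use assms B in auto)
  finally have "\<bar>\<Sum>k\<le>n. g k * cos (real l * node n k)\<bar> \<le> (real n + 1) * B" by (simp add: add.commute)
  then have "\<bar>coef n g l\<bar> \<le> 2 / (real n + 1) * ((real n + 1) * B)"
    unfolding coef_def abs_mult by (intro mult_mono) (auto intro: divide_right_mono)
  also have "\<dots> = 2 * B" by (simp add: field_simps)
  finally show ?thesis .
qed

text \<open>At \<open>t = \<alpha>\<close> only the truncated summand of \<open>quad\<close> is
  left; it is at most B because the last coefficient is at most 2 B. The difference to general t is
  \<open>quad_diff_bound\<close> with \<delta> = 2, allowed by pi < 4, and costs 8 B.\<close>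

lemma quad_bound:
  assumes g: "\<And>k. k \<le> n \<Longrightarrow> \<bar>g k\<bar> \<le> B" and t: "t \<in> {0..pi}" and \<alpha>: "\<alpha> \<in> {0..pi}"
  shows "\<bar>quad n \<alpha> t g\<bar> \<le> 9 * B"
proof -
  have B: "0 \<le> B" using g[of 0] by linarith
  have "\<bar>quad n \<alpha> t g - quad n \<alpha> \<alpha> g\<bar> \<le> 4 * B * 2"
  proof (cases "t \<le> \<alpha>")
    case True
    show ?thesis by (rule quad_diff_bound) (use g t \<alpha> True pi_less_4 in auto)
  next
    case False
    have "\<bar>quad n \<alpha> \<alpha> g - quad n \<alpha> t g\<bar> \<le> 4 * B * 2"
      by (rule quad_diff_bound) (use g t \<alpha> False pi_less_4 in auto)
    then show ?thesis by linarith
  qed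
  moreover have "\<bar>quad n \<alpha> \<alpha> g\<bar> \<le> B"
  proof -
    have "\<bar>quad n \<alpha> \<alpha> g\<bar> = \<bar>coef n g n\<bar> * \<bar>cos ((real n + 1) * \<alpha>)\<bar> / (2 * (real n + 1))"
      by (simp add: quad_def abs_mult)
    also have "\<dots> \<le> (2 * B) * 1 / (2 * 1)"
      using B by (intro frac_le mult_mono coef_bound g) auto
    finally show ?thesis by simp
  qed
  ultimately show ?thesis by linarith
qed

text \<open>The bound \<open>m \<le> n\<close> admits frequencies up to n - 1 only: then the
  coefficient of cos (n t) is zero and the additional summand of \<open>quad\<close>
  disappears.\<close>

lemma quad_exact:
  assumes "m \<le> n"
  shows "quad n \<alpha> t (\<lambda>k. \<Sum>l<m. a l * cos (real l * node n k)) = (\<Sum>l<m. a l * (anti l t - anti l \<alpha>))"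
proof -
  have c: "coef n (\<lambda>k. \<Sum>l<m. a l * cos (real l * node n k)) j = (if j < m then a j else 0)" if "j \<le> n" for j
  proof -
    have "coef n (\<lambda>k. \<Sum>l<m. a l * cos (real l * node n k)) j = (\<Sum>l<m. a l * (if l = j then 1 else 0))"
      unfolding coef_sum coef_cmult using assms that by (intro sum.cong refl) (auto simp: coef_cos)
    then show ?thesis by (simp add: if_distrib[of "\<lambda>x. _ * x"] cong: if_cong)
  qed
  have "(\<Sum>l\<le>n. (if l < m then a l else 0) * (anti l t - anti l \<alpha>)) = (\<Sum>l<m. a l * (anti l t - anti l \<alpha>))"
    by (rule sum.mono_neutral_cong_right) (use assms in auto)
  then show ?thesis using assms by (simp add: quad_def c)
qed

section \<open>Density and completeness of the cosines\<close>

definition cos_polys :: "(real \<Rightarrow> real) set" where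
  "cos_polys = {f. \<exists>m a. f = (\<lambda>t. \<Sum>l<m. a l * cos (real l * t))}"

lemma cos_polys_add:
  assumes "f \<in> cos_polys" "g \<in> cos_polys"
  shows "(\<lambda>t. f t + g t) \<in> cos_polys"
proof -
  obtain m a n b where f: "f = (\<lambda>t. \<Sum>l<m. a l * cos (real l * t))"
    and g: "g = (\<lambda>t. \<Sum>l<n. b l * cos (real l * t))"
    using assms unfolding cos_polys_def by blast
  have ext: "(\<Sum>l<m + n. (if l < k then c l else 0) * cos (real l * t)) = (\<Sum>l<k. c l * cos (real l * t))"
    if "k \<le> m + n" for k c t
    by (rule sum.mono_neutral_cong_right) (use that in auto)
  have "(\<lambda>t. f t + g t) = (\<lambda>t. \<Sum>l<m + n. ((if l < m then a l else 0) + (if l < n then b l else 0)) * cos (real l * t))"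
    unfolding distrib_right sum.distrib f g by (simp add: ext)
  then show ?thesis unfolding cos_polys_def by (intro CollectI exI)
qed

lemma cos_polys_cmult:
  assumes "f \<in> cos_polys"
  shows "(\<lambda>t. c * f t) \<in> cos_polys"
proof -
  obtain m a where f: "f = (\<lambda>t. \<Sum>l<m. a l * cos (real l * t))"
    using assms unfolding cos_polys_def by blast
  have "(\<lambda>t. c * f t) = (\<lambda>t. \<Sum>l<m. (c * a l) * cos (real l * t))"
    unfolding f sum_distrib_left by (simp add: mult.assoc)
  then show ?thesis unfolding cos_polys_def by (intro CollectI exI)
qed

lemma cos_polys_cos: "(\<lambda>t. cos (real l * t)) \<in> cos_polys"
proof -
  have "(\<lambda>t. cos (real l * t)) = (\<lambda>t. \<Sum>i<Suc l. (if i = l then 1 else 0) * cos (real i * t))"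
    by (simp add: if_distrib[of "\<lambda>x. x * _"] cong: if_cong)
  then show ?thesis unfolding cos_polys_def by (intro CollectI exI)
qed

lemma cos_polys_sum:
  "(\<And>i. i \<in> A \<Longrightarrow> f i \<in> cos_polys) \<Longrightarrow> (\<lambda>t. \<Sum>i\<in>A. f i t) \<in> cos_polys"
proof (induction A rule: infinite_finite_induct)
  case (insert x F)
  then show ?case by (simp add: cos_polys_add)
qed (use cos_polys_cmult[OF cos_polys_cos, of 0] in auto)

lemma cos_polys_mult:
  assumes "f \<in> cos_polys" "g \<in> cos_polys"
  shows "(\<lambda>t. f t * g t) \<in> cos_polys"
proof -
  obtain m a n b where f: "f = (\<lambda>t. \<Sum>l<m. a l * cos (real l * t))"
    and g: "g = (\<lambda>t. \<Sum>l<n. b l * cos (real l * t))"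
    using assms unfolding cos_polys_def by blast
  have "(\<lambda>t. f t * g t) = (\<lambda>t. \<Sum>i<m. \<Sum>j<n. (a i * b j) * (cos (real i * t) * cos (real j * t)))"
    unfolding f g sum_product by (simp add: mult_ac)
  moreover have "(\<lambda>t. cos (real i * t) * cos (real j * t)) \<in> cos_polys" for i j
  proof -
    have "(\<lambda>t. 1 / 2 * (cos (real (nat \<bar>int i - int j\<bar>) * t) + cos (real (i + j) * t))) \<in> cos_polys"
      by (intro cos_polys_cmult cos_polys_add cos_polys_cos)
    then show ?thesis by (simp only: cos_cos_nat) (simp add: field_simps)
  qed
  ultimately show ?thesis
    by (simp only:) (intro cos_polys_sum cos_polys_cmult)
qed

text \<open>Stone-Weierstrass: products of cosines are again sums of cosines, and cos alone
  separates the points of \<open>{0..pi}\<close>.\<close>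

lemma cos_poly_dense:
  assumes "continuous_on {0..pi} G" "0 < e"
  obtains m a where "\<And>t. t \<in> {0..pi} \<Longrightarrow> \<bar>G t - (\<Sum>l<m. a l * cos (real l * t))\<bar> < e"
proof -
  interpret function_ring_on cos_polys "{0..pi}"
  proof
    show "continuous_on {0..pi} f" if "f \<in> cos_polys" for f
      using that unfolding cos_polys_def by (auto intro!: continuous_intros)
    show "(\<lambda>_. c) \<in> cos_polys" for c
      using cos_polys_cmult[OF cos_polys_cos[of 0], of c] by simp
    show "\<exists>f\<in>cos_polys. f x \<noteq> f y" if "x \<in> {0..pi}" "y \<in> {0..pi}" "x \<noteq> y" for x y
      using that cos_inj_pi[of x y] cos_polys_cos[of 1] by auto
  qed (auto intro: cos_polys_add cos_polys_mult)
  obtain g where "g \<in> cos_polys" and g: "\<forall>t\<in>{0..pi}. \<bar>G t - g t\<bar> < e"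
    using Stone_Weierstrass_basic[OF assms] by blast
  then obtain m a where "g = (\<lambda>t. \<Sum>l<m. a l * cos (real l * t))"
    unfolding cos_polys_def by blast
  with g show ?thesis by (intro that[of a m]) simp
qed

text \<open>The factor \<open>sin u\<close> is the Jacobian of s = cos u. The sign is explicit
  because a set integral over a reversed interval is 0 rather than the negative.\<close>

definition signed_int :: "real \<Rightarrow> real \<Rightarrow> (real \<Rightarrow> real) \<Rightarrow> real" where
  "signed_int \<alpha> t G = (if t \<le> \<alpha> then integral {t..\<alpha>} (\<lambda>u. G u * sin u)
     else - integral {\<alpha>..t} (\<lambda>u. G u * sin u))"

text \<open>The polynomial part is integrated exactly, so only the remainder of size e counts: its
  quadrature is at most 9 e by \<open>quad_bound\<close>, and its true integral at most pi e <= 4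
  e.\<close>

lemma quad_error:
  assumes G: "continuous_on {0..pi} G" and t: "t \<in> {0..pi}" and \<alpha>: "\<alpha> \<in> {0..pi}"
    and "m \<le> n"
    and approx: "\<And>u. u \<in> {0..pi} \<Longrightarrow> \<bar>G u - (\<Sum>l<m. a l * cos (real l * u))\<bar> \<le> e"
  shows "\<bar>quad n \<alpha> t (\<lambda>k. G (node n k)) - signed_int \<alpha> t G\<bar> \<le> 13 * e"
proof -
  define P where "P u = (\<Sum>l<m. a l * cos (real l * u))" for u
  have P: "continuous_on S P" for S unfolding P_def by (intro continuous_intros)
  have e: "0 \<le> e" using approx[of 0] by auto
  have "\<bar>quad n \<alpha> t (\<lambda>k. G (node n k) - P (node n k))\<bar> \<le> 9 * e"
    using approx node_bounds by (intro quad_bound t \<alpha>) (auto simp: P_def less_imp_le)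
  then have 1: "\<bar>quad n \<alpha> t (\<lambda>k. G (node n k)) - (\<Sum>l<m. a l * (anti l t - anti l \<alpha>))\<bar> \<le> 9 * e"
    unfolding quad_diff P_def quad_exact[OF \<open>m \<le> n\<close>] .
  have 2: "\<bar>integral {x..y} (\<lambda>u. G u * sin u) - (\<Sum>l<m. a l * (anti l x - anti l y))\<bar> \<le> 4 * e"
    if xy: "0 \<le> x" "x \<le> y" "y \<le> pi" for x y
  proof -
    have c: "continuous_on {x..y} G" by (rule continuous_on_subset[OF G]) (use xy in auto)
    have "(\<Sum>l<m. a l * (anti l x - anti l y)) = integral {x..y} (\<lambda>u. P u * sin u)"
      unfolding P_def by (rule integral_unique[symmetric], rule anti_sum_integral, rule xy)
    then have "\<bar>integral {x..y} (\<lambda>u. G u * sin u) - (\<Sum>l<m. a l * (anti l x - anti l y))\<bar>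
       = norm (integral {x..y} (\<lambda>u. G u * sin u - P u * sin u))"
      by (subst Henstock_Kurzweil_Integration.integral_diff)
        (auto intro!: integrable_continuous_real continuous_intros c P)
    also have "\<dots> \<le> e * (y - x)"
    proof (rule integral_bound[OF xy(2)])
      show "norm (G u * sin u - P u * sin u) \<le> e" if "u \<in> {x..y}" for u
      proof -
        have "\<bar>(G u - P u) * sin u\<bar> \<le> e * 1"
          unfolding abs_mult using approx[of u] that xy e by (intro mult_mono) (auto simp: P_def)
        then show ?thesis by (simp add: algebra_simps)
      qed
    qed (intro continuous_intros c P)
    also have "\<dots> \<le> e * 4" using e xy pi_less_4 by (intro mult_left_mono) auto
    finally show ?thesis by (simp add: mult.commute)
  qed
  have "(\<Sum>l<m. a l * (anti l t - anti l \<alpha>)) = - (\<Sum>l<m. a l * (anti l \<alpha> - anti l t))"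
    unfolding sum_negf[symmetric] by (simp add: algebra_simps)
  then have "\<bar>signed_int \<alpha> t G - (\<Sum>l<m. a l * (anti l t - anti l \<alpha>))\<bar> \<le> 4 * e"
    using 2[of t \<alpha>] 2[of \<alpha> t] t \<alpha> by (auto simp: signed_int_def)
  with 1 show ?thesis by linarith
qed

lemma quad_tendsto:
  assumes G: "continuous_on {0..pi} G" and t: "t \<in> {0..pi}" and \<alpha>: "\<alpha> \<in> {0..pi}"
  shows "(\<lambda>n. quad n \<alpha> t (\<lambda>k. G (node n k))) \<longlonglongrightarrow> signed_int \<alpha> t G"
proof (rule LIMSEQ_I)
  fix r :: real assume "0 < r"
  \<comment> \<open>26 = 2 * 13, which leaves room for the strict inequality.\<close>
  then have "0 < r / 26" by simp
  obtain m a where a: "\<And>t. t \<in> {0..pi} \<Longrightarrow> \<bar>G t - (\<Sum>l<m. a l * cos (real l * t))\<bar> < r / 26"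
    using cos_poly_dense[OF G \<open>0 < r / 26\<close>] by blast
  have "\<bar>quad n \<alpha> t (\<lambda>k. G (node n k)) - signed_int \<alpha> t G\<bar> \<le> 13 * (r / 26)" if "m \<le> n" for n
    by (rule quad_error[OF G t \<alpha> that, where a = a]) (use a less_imp_le in blast)
  then show "\<exists>N. \<forall>n\<ge>N. norm (quad n \<alpha> t (\<lambda>k. G (node n k)) - signed_int \<alpha> t G) < r"
    using \<open>0 < r\<close> by (intro exI[of _ m]) force
qed

text \<open>Orthogonality to every cosine polynomial P gives that H^2 and H (H - P) have the same
  integral. For P uniformly close to H this is small, so H^2 integrates to 0 and, being continuous,
  vanishes.\<close>

lemma cos_complete:
  assumes H: "continuous_on {0..pi} H"
    and orth: "\<And>i. integral {0..pi} (\<lambda>t. H t * cos (real i * t)) = 0" and "t \<in> {0..pi}"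
  shows "H t = 0"
proof -
  have int: "f integrable_on {0..pi}" if "continuous_on {0..pi} f" for f :: "real \<Rightarrow> real"
    using that by (rule integrable_continuous_real)
  define B where "B = integral {0..pi} (\<lambda>t. \<bar>H t\<bar>)"
  have B: "0 \<le> B" unfolding B_def by (intro integral_nonneg int continuous_intros H) auto
  have "integral {0..pi} (\<lambda>t. (H t)\<^sup>2) \<le> 0"
  proof (rule field_le_epsilon)
    fix e :: real assume "0 < e"
    then have e: "0 < e / (B + 1)" using B by simp
    have B1: "B + 1 \<noteq> 0" using B by simp
    obtain m a where a: "\<And>t. t \<in> {0..pi} \<Longrightarrow> \<bar>H t - (\<Sum>l<m. a l * cos (real l * t))\<bar> < e / (B + 1)"
      using cos_poly_dense[OF H e] by blast
    have "integral {0..pi} (\<lambda>t. \<Sum>l<m. a l * (H t * cos (real l * t))) = (\<Sum>l<m. a l * integral {0..pi} (\<lambda>t. H t * cos (real l * t)))"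
      by (subst integral_sum) (auto intro!: int continuous_intros H)
    also have "\<dots> = 0" by (simp add: orth)
    finally have 0: "integral {0..pi} (\<lambda>t. \<Sum>l<m. a l * (H t * cos (real l * t))) = 0" .
    have "integral {0..pi} (\<lambda>t. (H t)\<^sup>2) = integral {0..pi} (\<lambda>t. (H t)\<^sup>2 - (\<Sum>l<m. a l * (H t * cos (real l * t))))"
      by (subst Henstock_Kurzweil_Integration.integral_diff) (auto intro!: int continuous_intros H simp: 0)
    also have "\<dots> \<le> integral {0..pi} (\<lambda>t. e / (B + 1) * \<bar>H t\<bar>)"
    proof (rule integral_le)
      fix t assume "t \<in> {0..pi}"
      have "(H t)\<^sup>2 - (\<Sum>l<m. a l * (H t * cos (real l * t))) = (H t - (\<Sum>l<m. a l * cos (real l * t))) * H t"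
        by (simp add: power2_eq_square algebra_simps sum_distrib_left)
      also have "\<dots> \<le> \<bar>H t - (\<Sum>l<m. a l * cos (real l * t))\<bar> * \<bar>H t\<bar>"
        unfolding abs_mult[symmetric] by simp
      also have "\<dots> \<le> e / (B + 1) * \<bar>H t\<bar>"
        using a[OF \<open>t \<in> {0..pi}\<close>] by (intro mult_right_mono) auto
      finally show "(H t)\<^sup>2 - (\<Sum>l<m. a l * (H t * cos (real l * t))) \<le> e / (B + 1) * \<bar>H t\<bar>" .
    qed (auto intro!: int continuous_intros H simp: B1)
    also have "\<dots> = e / (B + 1) * B" by (simp add: B_def)
    also have "\<dots> \<le> e" using B \<open>0 < e\<close> by (simp add: field_simps)
    finally show "integral {0..pi} (\<lambda>t. (H t)\<^sup>2) \<le> 0 + e" by simp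
  qed
  moreover have "0 \<le> integral {0..pi} (\<lambda>t. (H t)\<^sup>2)"
    by (intro integral_nonneg int continuous_intros H) auto
  ultimately have "integral {0..pi} (\<lambda>t. (H t)\<^sup>2) = 0" by simp
  then show ?thesis
    by (subst (asm) integral_eq_0_iff) (use \<open>t \<in> {0..pi}\<close> in \<open>auto intro!: continuous_intros H\<close>)
qed

section \<open>Decay of Chebyshev coefficients\<close>

text \<open>The bare integral, without the normalising factor of a Chebyshev coefficient: so the
  recurrence for derivatives has the same form at every index, 0 included.\<close>

definition cheb_coef :: "(real \<Rightarrow> real) \<Rightarrow> nat \<Rightarrow> real" where
  "cheb_coef F j = integral {0..pi} (\<lambda>t. F (cos t) * cos (real j * t))"

lemma continuous_on_cos_comp:
  assumes "continuous_on {-1..1} F"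
  shows "continuous_on {0..pi} (\<lambda>t. F (cos t))"
  by (rule continuous_on_compose2[OF assms]) (auto intro: continuous_intros)

text \<open>Integration by parts replaces j cos (j t) by sin (j t), without boundary terms because
  sin (j t) vanishes at 0 and pi. The chain rule supplies sin t, and sin t sin (j t) is half the
  difference of the two neighbouring cosines.\<close>

lemma cheb_coef_deriv:
  fixes F F' :: "real \<Rightarrow> real"
  assumes F: "\<And>s. s \<in> {-1..1} \<Longrightarrow> (F has_real_derivative F' s) (at s within {-1..1})"
    and F': "continuous_on {-1..1} F'" and "j > 0"
  shows "real j * cheb_coef F j = (cheb_coef F' (j - 1) - cheb_coef F' (j + 1)) / 2"
proof -
  have contF: "continuous_on {-1..1} F"
    using F by (rule DERIV_continuous_on)
  note c = continuous_on_cos_comp[OF contF] continuous_on_cos_comp[OF F']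
  have int: "f integrable_on {0..pi}" if "continuous_on {0..pi} f" for f :: "real \<Rightarrow> real"
    using that by (rule integrable_continuous_real)
  have dF: "((\<lambda>t. F (cos t)) has_real_derivative F' (cos t) * - sin t) (at t within {0..pi})" for t
  proof -
    have "(F has_real_derivative F' (cos t)) (at (cos t) within cos ` {0..pi})"
      by (rule has_field_derivative_subset[OF F]) auto
    moreover have "(cos has_real_derivative - sin t) (at t within {0..pi})"
      by (auto intro!: derivative_eq_intros)
    ultimately show ?thesis
      using DERIV_image_chain[of F "F' (cos t)" cos t "{0..pi}" "- sin t"] by (simp add: o_def)
  qed
  have "((\<lambda>t. F (cos t) * sin (real j * t)) has_real_derivative
      real j * (F (cos t) * cos (real j * t)) - F' (cos t) * (sin t * sin (real j * t))) (at t within {0..pi})" for t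
    by (auto intro!: derivative_eq_intros dF simp: algebra_simps)
  then have "((\<lambda>t. real j * (F (cos t) * cos (real j * t)) - F' (cos t) * (sin t * sin (real j * t))) has_integral
      F (cos pi) * sin (real j * pi) - F (cos 0) * sin (real j * 0)) {0..pi}"
    by (intro fundamental_theorem_of_calculus) (auto simp: has_real_derivative_iff_has_vector_derivative[symmetric])
  then have "integral {0..pi} (\<lambda>t. real j * (F (cos t) * cos (real j * t)) - F' (cos t) * (sin t * sin (real j * t))) = 0"
    by (auto dest: integral_unique)
  then have "real j * cheb_coef F j = integral {0..pi} (\<lambda>t. F' (cos t) * (sin t * sin (real j * t)))"
    by (subst (asm) Henstock_Kurzweil_Integration.integral_diff) (auto intro!: int continuous_intros c simp: cheb_coef_def)
  also have "\<dots> = integral {0..pi} (\<lambda>t. (F' (cos t) * cos (real (j - 1) * t) - F' (cos t) * cos (real (j + 1) * t)) / 2)"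
  proof (rule Henstock_Kurzweil_Integration.integral_cong)
    fix t
    have "real (j - 1) * t = real j * t - t" "real (j + 1) * t = real j * t + t"
      using \<open>j > 0\<close> by (auto simp: of_nat_diff algebra_simps)
    then show "F' (cos t) * (sin t * sin (real j * t)) = (F' (cos t) * cos (real (j - 1) * t) - F' (cos t) * cos (real (j + 1) * t)) / 2"
      by (simp only: cos_add cos_diff) (simp add: algebra_simps)
  qed
  also have "\<dots> = (cheb_coef F' (j - 1) - cheb_coef F' (j + 1)) / 2"
    unfolding cheb_coef_def
    by (subst Henstock_Kurzweil_Integration.integral_divide, subst Henstock_Kurzweil_Integration.integral_diff)
      (auto intro!: int continuous_intros c)
  finally show ?thesis .
qed

text \<open>Each derivative divides by the current index and moves it by one in either direction.
  Starting from j >= J + m, none of the m steps divides by less than J, so each gains a factor 1 /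
  J.\<close>

lemma cheb_coef_bound:
  fixes D :: "nat \<Rightarrow> real \<Rightarrow> real"
  assumes "\<And>i s. i < m \<Longrightarrow> s \<in> {-1..1} \<Longrightarrow> (D i has_real_derivative D (Suc i) s) (at s within {-1..1})"
    and "continuous_on {-1..1} (D m)" and "\<And>s. s \<in> {-1..1} \<Longrightarrow> \<bar>D m s\<bar> \<le> M"
    and "0 < J" "J + m \<le> j"
  shows "\<bar>cheb_coef (D 0) j\<bar> \<le> pi * M / real J ^ m"
  using assms
proof (induction m arbitrary: D j)
  case 0
  have M: "0 \<le> M" using 0(3)[of 0] by auto
  have "norm (cheb_coef (D 0) j) \<le> M * (pi - 0)"
    unfolding cheb_coef_def
  proof (rule integral_bound)
    show "norm (D 0 (cos t) * cos (real j * t)) \<le> M" if "t \<in> {0..pi}" for t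
    proof -
      have "\<bar>D 0 (cos t)\<bar> * \<bar>cos (real j * t)\<bar> \<le> M * 1"
        using 0(3) M by (intro mult_mono) auto
      then show ?thesis by (simp add: abs_mult)
    qed
  qed (auto intro!: continuous_intros continuous_on_cos_comp 0)
  then show ?case by (simp add: mult.commute)
next
  case (Suc m)
  have cont: "continuous_on {-1..1} (D (Suc 0))"
  proof (cases m)
    case 0
    then show ?thesis using Suc.prems(2) by simp
  next
    case (Suc m')
    then show ?thesis using Suc.prems(1)[of "Suc 0"] by (intro DERIV_continuous_on) auto
  qed
  have IH: "\<bar>cheb_coef (D (Suc 0)) j'\<bar> \<le> pi * M / real J ^ m" if "J + m \<le> j'" for j'
    by (rule Suc.IH[of "\<lambda>i. D (Suc i)"]) (use Suc.prems that in auto)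
  have j: "0 < j" using Suc.prems by simp
  have "real j * cheb_coef (D 0) j = (cheb_coef (D (Suc 0)) (j - 1) - cheb_coef (D (Suc 0)) (j + 1)) / 2"
    by (rule cheb_coef_deriv[OF _ cont j]) (use Suc.prems(1)[of 0] in auto)
  moreover have "real j * \<bar>cheb_coef (D 0) j\<bar> = \<bar>real j * cheb_coef (D 0) j\<bar>"
    by (simp add: abs_mult)
  ultimately have "real j * \<bar>cheb_coef (D 0) j\<bar> = \<bar>cheb_coef (D (Suc 0)) (j - 1) - cheb_coef (D (Suc 0)) (j + 1)\<bar> / 2"
    by simp
  also have "\<dots> \<le> pi * M / real J ^ m"
  proof -
    have "\<bar>cheb_coef (D (Suc 0)) (j - 1)\<bar> \<le> pi * M / real J ^ m" "\<bar>cheb_coef (D (Suc 0)) (j + 1)\<bar> \<le> pi * M / real J ^ m"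
      using Suc.prems(5) by (intro IH; simp)+
    moreover have "\<bar>x - y\<bar> / 2 \<le> z" if "\<bar>x\<bar> \<le> z" "\<bar>y\<bar> \<le> z" for x y z :: real
    proof -
      have "\<bar>x - y\<bar> \<le> 2 * z" using that by linarith
      then show ?thesis by simp
    qed
    ultimately show ?thesis by blast
  qed
  finally have *: "real j * \<bar>cheb_coef (D 0) j\<bar> \<le> pi * M / real J ^ m" .
  have "real J * \<bar>cheb_coef (D 0) j\<bar> \<le> real j * \<bar>cheb_coef (D 0) j\<bar>"
    using Suc.prems by (intro mult_right_mono) auto
  with * have "real J * \<bar>cheb_coef (D 0) j\<bar> \<le> pi * M / real J ^ m" by linarith
  then show ?case using \<open>0 < J\<close> by (simp add: field_simps)
qed

text \<open>Absolute summability gives a continuous uniform limit; termwise integration shows that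
  it has the cosine coefficients of \<open>G\<close>, and \<open>cos_complete\<close> identifies the
  two.\<close>

lemma cos_series_eq:
  assumes G: "continuous_on {0..pi} G"
    and a: "\<And>l. a l = (if l = 0 then 1 else 2) / pi * integral {0..pi} (\<lambda>t. G t * cos (real l * t))"
    and summ: "summable (\<lambda>l. \<bar>a l\<bar>)" and "t \<in> {0..pi}"
  shows "(\<lambda>l. a l * cos (real l * t)) sums G t"
proof -
  define S where "S t = (\<Sum>l. a l * cos (real l * t))" for t
  have bound: "norm (a l * cos (real l * t)) \<le> \<bar>a l\<bar>" for l t
    using mult_left_mono[of "\<bar>cos (real l * t)\<bar>" 1 "\<bar>a l\<bar>"] by (simp add: abs_mult)
  have unif: "uniform_limit {0..pi} (\<lambda>n t. \<Sum>l<n. a l * cos (real l * t)) S sequentially"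
    unfolding S_def by (rule Weierstrass_m_test[OF bound summ])
  have S: "continuous_on {0..pi} S"
    by (rule uniform_limit_theorem[OF _ unif]) (auto intro!: continuous_intros always_eventually)
  have "G t - S t = 0"
  proof (rule cos_complete[where H = "\<lambda>t. G t - S t"])
    fix i
    have unif': "uniform_limit {0..pi} (\<lambda>n t. (\<Sum>l<n. a l * cos (real l * t)) * cos (real i * t)) (\<lambda>t. S t * cos (real i * t)) sequentially"
      by (rule uniform_lim_mult[OF unif uniform_limit_const])
        (auto intro!: compact_imp_bounded compact_continuous_image continuous_intros S)
    obtain I J where I: "\<And>n. ((\<lambda>t. (\<Sum>l<n. a l * cos (real l * t)) * cos (real i * t)) has_integral I n) {0..pi}"
      and J: "((\<lambda>t. S t * cos (real i * t)) has_integral J) {0..pi}" and IJ: "I \<longlonglongrightarrow> J"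
      by (rule uniform_limit_integral[OF unif']) (auto intro!: continuous_intros)
    define w where "w = (if i = 0 then pi else pi / 2)"
    \<comment> \<open>Once n > i, the partial sum contains the frequency i and its i-th coefficient
      no longer changes.\<close>
    have "I n = a i * w" if "n > i" for n
    proof -
      have "((\<lambda>t. \<Sum>l<n. a l * (cos (real l * t) * cos (real i * t))) has_integral
          (\<Sum>l<n. a l * (if l = i then if l = 0 then pi else pi / 2 else 0))) {0..pi}"
        by (intro has_integral_sum has_integral_mult_right has_integral_cos_cos) auto
      moreover have "(\<Sum>l<n. a l * (if l = i then if l = 0 then pi else pi / 2 else 0)) = a i * w"
        using that by (simp add: w_def if_distrib[of "\<lambda>x. _ * x"] cong: if_cong)
      ultimately have "((\<lambda>t. (\<Sum>l<n. a l * cos (real l * t)) * cos (real i * t)) has_integral a i * w) {0..pi}"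
        by (simp add: sum_distrib_right mult.assoc)
      then show ?thesis using I has_integral_unique by blast
    qed
    then have "I \<longlonglongrightarrow> a i * w"
      by (intro tendsto_eventually eventually_sequentiallyI[of "Suc i"]) auto
    then have "J = a i * w" using IJ LIMSEQ_unique by blast
    also have "\<dots> = integral {0..pi} (\<lambda>t. G t * cos (real i * t))"
      by (simp add: a w_def)
    finally have "integral {0..pi} (\<lambda>t. S t * cos (real i * t)) = integral {0..pi} (\<lambda>t. G t * cos (real i * t))"
      using J integral_unique by blast
    then show "integral {0..pi} (\<lambda>t. (G t - S t) * cos (real i * t)) = 0"
      unfolding left_diff_distrib
      by (subst Henstock_Kurzweil_Integration.integral_diff)
        (auto intro!: integrable_continuous_real continuous_intros G S)
  qed (intro continuous_intros G S \<open>t \<in> {0..pi}\<close>)+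
  moreover have "summable (\<lambda>l. a l * cos (real l * t))"
    by (rule summable_comparison_test'[OF summ, of 0]) (rule bound)
  then have "(\<lambda>l. a l * cos (real l * t)) sums S t"
    unfolding S_def by (rule summable_sums)
  ultimately show ?thesis by simp
qed

text \<open>For l >= 1, 1 / l^2 <= 2 / (l (l + 1)), and the right side telescopes.\<close>

lemma inverse_square_tail:
  assumes "0 < n"
  shows "(\<Sum>l=n..<N. 1 / (real l)\<^sup>2) \<le> 2 / real n"
proof (cases "n \<le> N")
  case True
  have "(\<Sum>l=n..<N. 1 / (real l)\<^sup>2) \<le> (\<Sum>l=n..<N. (- 2 / real (Suc l)) - (- 2 / real l))"
  proof (rule sum_mono)
    fix l assume "l \<in> {n..<N}"
    then have "1 \<le> real l" using assms by auto
    then show "1 / (real l)\<^sup>2 \<le> (- 2 / real (Suc l)) - (- 2 / real l)"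
      by (simp add: divide_simps) (simp add: algebra_simps power2_eq_square)
  qed
  also have "\<dots> = 2 / real n - 2 / real N"
    by (subst sum_Suc_diff'[OF True]) simp
  finally show ?thesis by (smt (verit) divide_nonneg_nonneg of_nat_0_le_iff)
qed simp

text \<open>The approximant is a partial sum of the cosine series. As l >= n >= 2 m in the tail, the
  base l - m in \<open>cheb_coef_bound\<close> is at least l / 2, whence the factor 2^m. Splitting
  l^m into l^(m - 2) >= n^(m - 2) and l^2, whose reciprocals have tail at most 2 / n, gives n^(1 -
  m).\<close>

lemma cheb_approx:
  fixes D :: "nat \<Rightarrow> real \<Rightarrow> real"
  assumes D: "\<And>i s. i < m \<Longrightarrow> s \<in> {-1..1} \<Longrightarrow> (D i has_real_derivative D (Suc i) s) (at s within {-1..1})"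
    and contD: "continuous_on {-1..1} (D m)" and M: "\<And>s. s \<in> {-1..1} \<Longrightarrow> \<bar>D m s\<bar> \<le> M"
    and m: "2 \<le> m" and n: "2 * m \<le> n"
  obtains a where "\<And>t. t \<in> {0..pi} \<Longrightarrow>
    \<bar>D 0 (cos t) - (\<Sum>l<n. a l * cos (real l * t))\<bar> \<le> 4 * 2 ^ m * M / real n ^ (m - 1)"
proof -
  define G where "G t = D 0 (cos t)" for t
  define a where "a l = (if l = 0 then 1 else 2) / pi * integral {0..pi} (\<lambda>t. G t * cos (real l * t))" for l
  have M0: "0 \<le> M" using M[of 0] by auto
  have "continuous_on {-1..1} (D 0)"
    using D[of 0] m by (intro DERIV_continuous_on) auto
  then have G: "continuous_on {0..pi} G" unfolding G_def by (rule continuous_on_cos_comp)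
  define K where "K = 2 * 2 ^ m * M"
  have a_bound: "\<bar>a l\<bar> \<le> K / real n ^ (m - 2) * (1 / (real l)\<^sup>2)" if "n \<le> l" for l
  proof -
    have l: "0 < l" "2 * m \<le> l" using that m n by auto
    have "\<bar>cheb_coef (D 0) l\<bar> \<le> pi * M / real (l - m) ^ m"
      by (rule cheb_coef_bound[OF D contD M]) (use l m in auto)
    also have "\<dots> \<le> pi * M / (real l / 2) ^ m"
      using M0 l m by (intro divide_left_mono power_mono mult_pos_pos mult_nonneg_nonneg) (auto simp: of_nat_diff)
    also have "\<dots> = pi / 2 * (K / real l ^ m)" by (simp add: K_def power_divide)
    finally have "2 / pi * \<bar>cheb_coef (D 0) l\<bar> \<le> 2 / pi * (pi / 2 * (K / real l ^ m))"
      by (intro mult_left_mono) auto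
    also have "2 / pi * \<bar>cheb_coef (D 0) l\<bar> = \<bar>a l\<bar>"
      using l by (simp add: a_def G_def cheb_coef_def abs_mult)
    also have "2 / pi * (pi / 2 * (K / real l ^ m)) = K / (real l ^ (m - 2) * (real l)\<^sup>2)"
    proof -
      have "real l ^ m = real l ^ (m - 2) * (real l)\<^sup>2"
        using m by (metis le_add_diff_inverse2 power_add)
      then show ?thesis by simp
    qed
    also have "\<dots> \<le> K / (real n ^ (m - 2) * (real l)\<^sup>2)"
      using M0 l that n m by (intro divide_left_mono mult_right_mono power_mono mult_pos_pos) (auto simp: K_def)
    finally show ?thesis by simp
  qed
  have tail: "(\<Sum>l=n..<N. \<bar>a l\<bar>) \<le> 4 * 2 ^ m * M / real n ^ (m - 1)" for N
  proof -
    have "(\<Sum>l=n..<N. \<bar>a l\<bar>) \<le> K / real n ^ (m - 2) * (\<Sum>l=n..<N. 1 / (real l)\<^sup>2)"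
      unfolding sum_distrib_left by (intro sum_mono a_bound) auto
    also have "\<dots> \<le> K / real n ^ (m - 2) * (2 / real n)"
      using M0 m n by (intro mult_left_mono inverse_square_tail) (auto simp: K_def)
    also have "\<dots> = 4 * 2 ^ m * M / (real n ^ (m - 2) * real n)" by (simp add: K_def)
    also have "real n ^ (m - 2) * real n = real n ^ (m - 1)"
      using m by (simp flip: power_Suc2 add: Suc_diff_le numeral_2_eq_2 Suc_diff_Suc)
    finally show ?thesis .
  qed
  have summ: "summable (\<lambda>l. \<bar>a l\<bar>)"
  proof (rule summable_comparison_test'[of "\<lambda>l. K / real n ^ (m - 2) * (1 / (real l)\<^sup>2)" n])
    show "summable (\<lambda>l. K / real n ^ (m - 2) * (1 / (real l)\<^sup>2))"
      using inverse_power_summable[of 2, where ?'a = real] by (intro summable_mult) (simp add: inverse_eq_divide)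
  qed (use a_bound in auto)
  show ?thesis
  proof (rule that[of a])
    fix t assume t: "t \<in> {0..pi}"
    have s: "(\<lambda>N. (\<Sum>l<N. a l * cos (real l * t)) - (\<Sum>l<n. a l * cos (real l * t))) \<longlonglongrightarrow> G t - (\<Sum>l<n. a l * cos (real l * t))"
      using cos_series_eq[OF G a_def summ t] unfolding sums_def by (intro tendsto_diff tendsto_const)
    have "\<bar>(\<Sum>l<N. a l * cos (real l * t)) - (\<Sum>l<n. a l * cos (real l * t))\<bar> \<le> 4 * 2 ^ m * M / real n ^ (m - 1)"
      if "n \<le> N" for N
    proof -
      have "(\<Sum>l<N. a l * cos (real l * t)) - (\<Sum>l<n. a l * cos (real l * t)) = (\<Sum>l=n..<N. a l * cos (real l * t))"
        using sum.atLeastLessThan_concat[of 0 n N "\<lambda>l. a l * cos (real l * t)"] that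
        by (simp add: lessThan_atLeast0)
      also have "\<bar>\<dots>\<bar> \<le> (\<Sum>l=n..<N. \<bar>a l * cos (real l * t)\<bar>)" by (rule sum_abs)
      also have "\<dots> \<le> (\<Sum>l=n..<N. \<bar>a l\<bar>)"
        unfolding abs_mult by (intro sum_mono mult_left_le) auto
      finally show ?thesis using tail[of N] by linarith
    qed
    then have "\<bar>G t - (\<Sum>l<n. a l * cos (real l * t))\<bar> \<le> 4 * 2 ^ m * M / real n ^ (m - 1)"
      by (intro LIMSEQ_le_const2[OF tendsto_rabs[OF s]]) blast
    then show "\<bar>D 0 (cos t) - (\<Sum>l<n. a l * cos (real l * t))\<bar> \<le> 4 * 2 ^ m * M / real n ^ (m - 1)"
      by (simp add: G_def)
  qed
qed

section \<open>Stability of the discrete operators\<close>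

lemma quad_diff_bound_abs:
  assumes g: "\<And>k. k \<le> n \<Longrightarrow> \<bar>g k\<bar> \<le> B" and st: "s \<in> {0..pi}" "t \<in> {0..pi}" and "0 < \<delta>" "\<bar>s - t\<bar> \<le> \<delta>\<^sup>2"
  shows "\<bar>quad n \<alpha> s g - quad n \<alpha> t g\<bar> \<le> 4 * B * \<delta>"
proof (cases "s \<le> t")
  case True
  show ?thesis by (rule quad_diff_bound) (use assms True in auto)
next
  case False
  have "\<bar>quad n \<alpha> t g - quad n \<alpha> s g\<bar> \<le> 4 * B * \<delta>"
    by (rule quad_diff_bound) (use assms False in auto)
  then show ?thesis by linarith
qed

lemma continuous_on_square_slice:
  assumes "continuous_on (A \<times> B) (\<lambda>(t, u). \<kappa> t u)" "t \<in> A"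
  shows "continuous_on B (\<kappa> t)"
proof -
  have "continuous_on B (\<lambda>u. (\<lambda>(t, u). \<kappa> t u) (t, u))"
    by (rule continuous_on_compose2[OF assms(1)]) (use assms(2) in \<open>auto intro: continuous_intros\<close>)
  then show ?thesis by simp
qed

lemma square_bound:
  fixes \<kappa> :: "real \<Rightarrow> real \<Rightarrow> real"
  assumes "continuous_on ({a..b} \<times> {c..d}) (\<lambda>(t, u). \<kappa> t u)"
  obtains B where "0 < B" "\<And>t u. t \<in> {a..b} \<Longrightarrow> u \<in> {c..d} \<Longrightarrow> \<bar>\<kappa> t u\<bar> \<le> B"
proof -
  have "compact ((\<lambda>(t, u). \<kappa> t u) ` ({a..b} \<times> {c..d}))"
    by (intro compact_continuous_image assms compact_Times) auto
  then obtain B where "0 < B" "\<forall>x\<in>(\<lambda>(t, u). \<kappa> t u) ` ({a..b} \<times> {c..d}). norm x \<le> B"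
    using compact_imp_bounded bounded_pos by blast
  then show ?thesis by (intro that[of B]) auto
qed

text \<open>The modulus \<open>d\<close> depends on neither \<open>n\<close> nor \<open>w\<close>,
  which is the compactness shared by all discrete operators. A change of t moves both the endpoint
  of integration and the kernel parameter: the first is absorbed by
  \<open>quad_diff_bound_abs\<close>, the second by uniform continuity and
  \<open>quad_bound\<close>.\<close>

lemma quad_kernel_equicontinuous:
  fixes \<kappa> :: "real \<Rightarrow> real \<Rightarrow> real"
  assumes \<kappa>: "continuous_on ({0..pi} \<times> {0..pi}) (\<lambda>(t, u). \<kappa> t u)" and "0 < e" and \<alpha>: "\<alpha> \<in> {0..pi}"
  obtains d where "0 < d"
    "\<And>n w s t. (\<And>k. k \<le> n \<Longrightarrow> \<bar>w k\<bar> \<le> 1) \<Longrightarrow> s \<in> {0..pi} \<Longrightarrow> t \<in> {0..pi} \<Longrightarrow> \<bar>s - t\<bar> < d \<Longrightarrow>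
       \<bar>quad n \<alpha> s (\<lambda>k. \<kappa> s (node n k) * w k) - quad n \<alpha> t (\<lambda>k. \<kappa> t (node n k) * w k)\<bar> < e"
proof -
  obtain B where B: "0 < B" "\<And>t u. t \<in> {0..pi} \<Longrightarrow> u \<in> {0..pi} \<Longrightarrow> \<bar>\<kappa> t u\<bar> \<le> B"
    by (rule square_bound[OF \<kappa>]) blast
  have "uniformly_continuous_on ({0..pi} \<times> {0..pi}) (\<lambda>(t, u). \<kappa> t u)"
    by (intro compact_uniformly_continuous \<kappa> compact_Times) auto
  then obtain d where d: "0 < d" and
    "\<And>x y. x \<in> {0..pi} \<times> {0..pi} \<Longrightarrow> y \<in> {0..pi} \<times> {0..pi} \<Longrightarrow> dist y x < d \<Longrightarrow> dist ((\<lambda>(t, u). \<kappa> t u) y) ((\<lambda>(t, u). \<kappa> t u) x) < e / 27"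
    using uniformly_continuous_onE[of _ _ "e / 27"] \<open>0 < e\<close>
    by (metis divide_pos_pos zero_less_numeral)
  from this(2)[of "(_, _)" "(_, _)"]
  have \<kappa>d: "\<bar>\<kappa> s u - \<kappa> t u\<bar> < e / 27" if "s \<in> {0..pi}" "t \<in> {0..pi}" "u \<in> {0..pi}" "\<bar>s - t\<bar> < d" for s t u
    using that by (auto simp: dist_Pair_Pair dist_real_def)
  \<comment> \<open>Chosen so that 4 B \<delta> = e / 3; the kernel part contributes 9 (e / 27) = e
    / 3 as well.\<close>
  define \<delta> where "\<delta> = e / (12 * B)"
  have \<delta>: "0 < \<delta>" using \<open>0 < e\<close> B by (simp add: \<delta>_def)
  show ?thesis
  proof (rule that[of "min d (\<delta>\<^sup>2)"])
    fix n :: nat and w :: "nat \<Rightarrow> real" and s t :: real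
    assume w: "\<And>k. k \<le> n \<Longrightarrow> \<bar>w k\<bar> \<le> 1" and s: "s \<in> {0..pi}" and t: "t \<in> {0..pi}" and st: "\<bar>s - t\<bar> < min d (\<delta>\<^sup>2)"
    have nd: "node n k \<in> {0..pi}" if "k \<le> n" for k using node_bounds[OF that] by auto
    have "\<bar>quad n \<alpha> s (\<lambda>k. \<kappa> s (node n k) * w k) - quad n \<alpha> t (\<lambda>k. \<kappa> s (node n k) * w k)\<bar> \<le> 4 * B * \<delta>"
    proof (rule quad_diff_bound_abs[OF _ s t \<delta>])
      show "\<bar>\<kappa> s (node n k) * w k\<bar> \<le> B" if "k \<le> n" for k
        using mult_mono[OF B(2)[OF s nd[OF that]] w[OF that]] B(1) by (simp add: abs_mult)
    qed (use st in auto)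
    also have "\<dots> = e / 3" using B by (simp add: \<delta>_def)
    finally have 1: "\<bar>quad n \<alpha> s (\<lambda>k. \<kappa> s (node n k) * w k) - quad n \<alpha> t (\<lambda>k. \<kappa> s (node n k) * w k)\<bar> \<le> e / 3" .
    have "\<bar>quad n \<alpha> t (\<lambda>k. \<kappa> s (node n k) * w k - \<kappa> t (node n k) * w k)\<bar> \<le> 9 * (e / 27)"
    proof (rule quad_bound[OF _ t \<alpha>])
      show "\<bar>\<kappa> s (node n k) * w k - \<kappa> t (node n k) * w k\<bar> \<le> e / 27" if "k \<le> n" for k
        using mult_mono[OF less_imp_le[OF \<kappa>d[OF s t nd[OF that]]] w[OF that]] \<open>0 < e\<close> st
        by (simp add: abs_mult left_diff_distrib[symmetric])
    qed
    then show "\<bar>quad n \<alpha> s (\<lambda>k. \<kappa> s (node n k) * w k) - quad n \<alpha> t (\<lambda>k. \<kappa> t (node n k) * w k)\<bar> < e"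
      using 1 \<open>0 < e\<close> unfolding quad_diff by linarith
  qed (use d \<delta> in auto)
qed

text \<open>Nystrom extension: the data live on the nodes, the result is a function of every angle
  t. The endpoint pi is s = -1 and yields the integral from the left; 0 is s = 1, and the
  orientation from t to 0 explains the minus sign. Later \<open>h\<close> is (b - a) / 2.\<close>

definition disc_op :: "real \<Rightarrow> (real \<Rightarrow> real \<Rightarrow> real) \<Rightarrow> (real \<Rightarrow> real \<Rightarrow> real) \<Rightarrow> nat \<Rightarrow> (nat \<Rightarrow> real) \<Rightarrow> real \<Rightarrow> real" where
  "disc_op h \<kappa>1 \<kappa>2 n v t = h * (quad n pi t (\<lambda>k. \<kappa>1 t (node n k) * v k) - quad n 0 t (\<lambda>k. \<kappa>2 t (node n k) * v k))"

definition cont_op :: "real \<Rightarrow> (real \<Rightarrow> real \<Rightarrow> real) \<Rightarrow> (real \<Rightarrow> real \<Rightarrow> real) \<Rightarrow> (real \<Rightarrow> real) \<Rightarrow> real \<Rightarrow> real" where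
  "cont_op h \<kappa>1 \<kappa>2 X t = h * (signed_int pi t (\<lambda>u. \<kappa>1 t u * X u) - signed_int 0 t (\<lambda>u. \<kappa>2 t u * X u))"

lemma disc_op_add: "disc_op h \<kappa>1 \<kappa>2 n (\<lambda>k. v k + w k) t = disc_op h \<kappa>1 \<kappa>2 n v t + disc_op h \<kappa>1 \<kappa>2 n w t"
  unfolding disc_op_def distrib_left[of "_ :: real" "v _"] quad_add by (simp add: algebra_simps)

lemma disc_op_cmult: "disc_op h \<kappa>1 \<kappa>2 n (\<lambda>k. c * v k) t = c * disc_op h \<kappa>1 \<kappa>2 n v t"
proof -
  have "quad n \<alpha> t (\<lambda>k. f k * (c * v k)) = c * quad n \<alpha> t (\<lambda>k. f k * v k)" for \<alpha> f
    using quad_cmult[of n \<alpha> t c "\<lambda>k. f k * v k"] by (simp add: mult_ac)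
  then show ?thesis by (simp add: disc_op_def right_diff_distrib mult.left_commute)
qed

lemma disc_op_bound:
  fixes \<kappa>1 \<kappa>2 :: "real \<Rightarrow> real \<Rightarrow> real"
  assumes \<kappa>1: "continuous_on ({0..pi} \<times> {0..pi}) (\<lambda>(t, u). \<kappa>1 t u)"
    and \<kappa>2: "continuous_on ({0..pi} \<times> {0..pi}) (\<lambda>(t, u). \<kappa>2 t u)"
  obtains C where "0 < C" "\<And>n v t B. (\<And>k. k \<le> n \<Longrightarrow> \<bar>v k\<bar> \<le> B) \<Longrightarrow> t \<in> {0..pi} \<Longrightarrow>
    \<bar>disc_op h \<kappa>1 \<kappa>2 n v t\<bar> \<le> C * B"
proof -
  obtain B1 where B1: "0 < B1" "\<And>t u. t \<in> {0..pi} \<Longrightarrow> u \<in> {0..pi} \<Longrightarrow> \<bar>\<kappa>1 t u\<bar> \<le> B1"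
    by (rule square_bound[OF \<kappa>1]) blast
  obtain B2 where B2: "0 < B2" "\<And>t u. t \<in> {0..pi} \<Longrightarrow> u \<in> {0..pi} \<Longrightarrow> \<bar>\<kappa>2 t u\<bar> \<le> B2"
    by (rule square_bound[OF \<kappa>2]) blast
  show ?thesis
  proof (rule that[of "(\<bar>h\<bar> + 1) * (9 * B1 + 9 * B2)"])
    fix n :: nat and v :: "nat \<Rightarrow> real" and t B :: real assume v: "\<And>k. k \<le> n \<Longrightarrow> \<bar>v k\<bar> \<le> B" and t: "t \<in> {0..pi}"
    have B: "0 \<le> B" using v[of 0] by linarith
    have q: "\<bar>quad n \<alpha> t (\<lambda>k. \<kappa> t (node n k) * v k)\<bar> \<le> 9 * (B' * B)"
      if "\<alpha> \<in> {0..pi}" "0 < B'" "\<And>t u. t \<in> {0..pi} \<Longrightarrow> u \<in> {0..pi} \<Longrightarrow> \<bar>\<kappa> t u\<bar> \<le> B'" for \<alpha> B' :: real and \<kappa> :: "real \<Rightarrow> real \<Rightarrow> real"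
    proof (rule quad_bound[OF _ t that(1)])
      fix k assume "k \<le> n"
      then show "\<bar>\<kappa> t (node n k) * v k\<bar> \<le> B' * B"
        unfolding abs_mult using node_bounds[of k n] by (intro mult_mono that(3) v t) (use that in auto)
    qed
    have "\<bar>quad n pi t (\<lambda>k. \<kappa>1 t (node n k) * v k) - quad n 0 t (\<lambda>k. \<kappa>2 t (node n k) * v k)\<bar> \<le> 9 * (B1 * B) + 9 * (B2 * B)"
      using q[OF _ B1, of pi] q[OF _ B2, of 0] by fastforce
    then have "\<bar>disc_op h \<kappa>1 \<kappa>2 n v t\<bar> \<le> (\<bar>h\<bar> + 1) * (9 * (B1 * B) + 9 * (B2 * B))"
      unfolding disc_op_def abs_mult by (intro mult_mono) auto
    then show "\<bar>disc_op h \<kappa>1 \<kappa>2 n v t\<bar> \<le> (\<bar>h\<bar> + 1) * (9 * B1 + 9 * B2) * B"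
      by (simp add: algebra_simps)
  qed (use B1 B2 in \<open>auto intro!: mult_pos_pos add_nonneg_pos\<close>)
qed

text \<open>The discrete operators are collectively compact and converge pointwise to the continuous
  one. A sequence of normalised almost-null vectors therefore subconverges to a null function of
  the limit operator.\<close>

lemma disc_op_stable:
  fixes \<kappa>1 \<kappa>2 :: "real \<Rightarrow> real \<Rightarrow> real"
  assumes \<kappa>1: "continuous_on ({0..pi} \<times> {0..pi}) (\<lambda>(t, u). \<kappa>1 t u)"
    and \<kappa>2: "continuous_on ({0..pi} \<times> {0..pi}) (\<lambda>(t, u). \<kappa>2 t u)"
    and inj: "\<And>X t. continuous_on {0..pi} X \<Longrightarrow> (\<And>t. t \<in> {0..pi} \<Longrightarrow> X t + cont_op h \<kappa>1 \<kappa>2 X t = 0) \<Longrightarrow>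
      t \<in> {0..pi} \<Longrightarrow> X t = 0"
  shows "\<exists>N c. 0 < c \<and> (\<forall>n\<ge>N. \<forall>v \<delta>. (\<forall>i\<le>n. \<bar>v i + disc_op h \<kappa>1 \<kappa>2 n v (node n i)\<bar> \<le> \<delta>) \<longrightarrow> (\<forall>i\<le>n. \<bar>v i\<bar> \<le> c * \<delta>))"
proof (rule ccontr)
  let ?Z = "disc_op h \<kappa>1 \<kappa>2"
  assume neg: "\<not> ?thesis"
  \<comment> \<open>The negated claim is used with N = j and c = j + 1. Dividing a counterexample by
    its maximum modulus \<mu> makes the maximum 1 and the residual at most 1 / (j + 1).\<close>
  have "\<exists>n w. j \<le> n \<and> (\<forall>i\<le>n. \<bar>w i\<bar> \<le> 1) \<and> (\<exists>i\<le>n. \<bar>w i\<bar> = 1) \<and> (\<forall>i\<le>n. \<bar>w i + ?Z n w (node n i)\<bar> \<le> 1 / (real j + 1))" for j :: nat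
  proof -
    have "\<not> (0 < real j + 1 \<and> (\<forall>n\<ge>j. \<forall>v \<delta>. (\<forall>i\<le>n. \<bar>v i + ?Z n v (node n i)\<bar> \<le> \<delta>) \<longrightarrow> (\<forall>i\<le>n. \<bar>v i\<bar> \<le> (real j + 1) * \<delta>)))"
      using neg by blast
    moreover have "0 < real j + 1" by simp
    ultimately obtain n v \<delta> i where n: "j \<le> n" and \<delta>: "\<And>i. i \<le> n \<Longrightarrow> \<bar>v i + ?Z n v (node n i)\<bar> \<le> \<delta>"
      and i: "i \<le> n" "\<not> \<bar>v i\<bar> \<le> (real j + 1) * \<delta>"
      by blast
    define \<mu> where "\<mu> = Max ((\<lambda>i. \<bar>v i\<bar>) ` {..n})"
    have le: "\<bar>v i\<bar> \<le> \<mu>" if "i \<le> n" for i unfolding \<mu>_def using that by (intro Max_ge) auto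
    have "\<mu> \<in> (\<lambda>i. \<bar>v i\<bar>) ` {..n}" unfolding \<mu>_def by (intro Max_in) auto
    then obtain i0 where i0: "i0 \<le> n" "\<mu> = \<bar>v i0\<bar>" by auto
    have "0 \<le> \<delta>" using \<delta>[of 0] by linarith
    then have "0 \<le> (real j + 1) * \<delta>" by simp
    then have \<mu>: "0 < \<mu>" "(real j + 1) * \<delta> < \<mu>" using i le[of i] by linarith+
    define w where "w k = (1 / \<mu>) * v k" for k
    have Z: "?Z n w t = (1 / \<mu>) * ?Z n v t" for t
      unfolding w_def by (rule disc_op_cmult)
    have "\<bar>w i + ?Z n w (node n i)\<bar> \<le> 1 / (real j + 1)" if "i \<le> n" for i
    proof -
      have "\<bar>w i + ?Z n w (node n i)\<bar> = (1 / \<mu>) * \<bar>v i + ?Z n v (node n i)\<bar>"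
        unfolding Z w_def distrib_left[symmetric] abs_mult using \<mu> by simp
      also have "\<dots> \<le> (1 / \<mu>) * \<delta>" using \<delta>[OF that] \<mu> by (intro mult_left_mono) auto
      also have "\<dots> \<le> 1 / (real j + 1)" using \<mu> by (simp add: field_simps)
      finally show ?thesis .
    qed
    moreover have "\<forall>i\<le>n. \<bar>w i\<bar> \<le> 1" using le \<mu> by (auto simp: w_def abs_mult)
    moreover have "\<exists>i\<le>n. \<bar>w i\<bar> = 1" using i0 \<mu> by (intro exI[of _ i0]) (simp add: w_def abs_mult)
    ultimately show ?thesis using n by blast
  qed
  then obtain \<nu> w where \<nu>: "\<And>j::nat. j \<le> \<nu> j" and w: "\<And>j i. i \<le> \<nu> j \<Longrightarrow> \<bar>w j i\<bar> \<le> 1"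
    and w1: "\<And>j. \<exists>i\<le>\<nu> j. \<bar>w j i\<bar> = 1"
    and res: "\<And>j i. i \<le> \<nu> j \<Longrightarrow> \<bar>w j i + ?Z (\<nu> j) (w j) (node (\<nu> j) i)\<bar> \<le> 1 / (real j + 1)"
    by metis
  have nd: "node n k \<in> {0..pi}" if "k \<le> n" for n k using node_bounds[OF that] by auto
  obtain C where C: "0 < C" "\<And>n v t B. (\<And>k. k \<le> n \<Longrightarrow> \<bar>v k\<bar> \<le> B) \<Longrightarrow> t \<in> {0..pi} \<Longrightarrow> \<bar>?Z n v t\<bar> \<le> C * B"
    by (rule disc_op_bound[OF \<kappa>1 \<kappa>2, of h]) blast
  define F where "F j t = ?Z (\<nu> j) (w j) t" for j t
  obtain g r where g: "continuous_on {0..pi} g" and r: "strict_mono (r :: nat \<Rightarrow> nat)"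
    and conv: "\<And>e. 0 < e \<Longrightarrow> \<exists>N. \<forall>n x. n \<ge> N \<and> x \<in> {0..pi} \<longrightarrow> norm (F (r n) x - g x) < e"
  proof (rule Arzela_Ascoli[of "{0..pi}" F "C * 1"])
    show "norm (F j t) \<le> C * 1" if "t \<in> {0..pi}" for j t
      unfolding F_def real_norm_def by (rule C(2)) (use w that in auto)
    show "\<exists>d>0. \<forall>j y. y \<in> {0..pi} \<and> norm (x - y) < d \<longrightarrow> norm (F j x - F j y) < e" if x: "x \<in> {0..pi}" and "0 < e" for x e
    proof -
      \<comment> \<open>Two quadratures, each varying by less than e', are multiplied by h, and
        \<open>2 * \<bar>h\<bar> * e' < e\<close> also for h = 0.\<close>
      define e' where "e' = e / (2 * (\<bar>h\<bar> + 1))"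
      have e': "0 < e'" using \<open>0 < e\<close> by (simp add: e'_def add_nonneg_pos)
      obtain d1 where d1: "0 < d1" "\<And>n w s t. (\<And>k. k \<le> n \<Longrightarrow> \<bar>w k\<bar> \<le> 1) \<Longrightarrow> s \<in> {0..pi} \<Longrightarrow> t \<in> {0..pi} \<Longrightarrow> \<bar>s - t\<bar> < d1 \<Longrightarrow>
         \<bar>quad n pi s (\<lambda>k. \<kappa>1 s (node n k) * w k) - quad n pi t (\<lambda>k. \<kappa>1 t (node n k) * w k)\<bar> < e'"
        by (rule quad_kernel_equicontinuous[OF \<kappa>1 e', of pi]) auto
      obtain d2 where d2: "0 < d2" "\<And>n w s t. (\<And>k. k \<le> n \<Longrightarrow> \<bar>w k\<bar> \<le> 1) \<Longrightarrow> s \<in> {0..pi} \<Longrightarrow> t \<in> {0..pi} \<Longrightarrow> \<bar>s - t\<bar> < d2 \<Longrightarrow>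
         \<bar>quad n 0 s (\<lambda>k. \<kappa>2 s (node n k) * w k) - quad n 0 t (\<lambda>k. \<kappa>2 t (node n k) * w k)\<bar> < e'"
        by (rule quad_kernel_equicontinuous[OF \<kappa>2 e', of 0]) auto
      have "\<bar>F j x - F j y\<bar> < e" if y: "y \<in> {0..pi}" "\<bar>x - y\<bar> < min d1 d2" for j y
      proof -
        let ?q1 = "\<lambda>s. quad (\<nu> j) pi s (\<lambda>k. \<kappa>1 s (node (\<nu> j) k) * w j k)"
        let ?q2 = "\<lambda>s. quad (\<nu> j) 0 s (\<lambda>k. \<kappa>2 s (node (\<nu> j) k) * w j k)"
        have "\<bar>?q1 x - ?q1 y\<bar> < e'" "\<bar>?q2 x - ?q2 y\<bar> < e'"
          using y by (auto intro!: d1(2) d2(2) w x)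
        then have "\<bar>(?q1 x - ?q2 x) - (?q1 y - ?q2 y)\<bar> < 2 * e'" by linarith
        then have "\<bar>h\<bar> * \<bar>(?q1 x - ?q2 x) - (?q1 y - ?q2 y)\<bar> \<le> \<bar>h\<bar> * (2 * e')"
          by (intro mult_left_mono) auto
        also have "\<dots> < e" using \<open>0 < e\<close> by (simp add: e'_def field_simps)
        finally show ?thesis
          unfolding F_def disc_op_def right_diff_distrib[symmetric] abs_mult .
      qed
      then show ?thesis using d1 d2 by (intro exI[of _ "min d1 d2"]) auto
    qed
  qed auto
  \<comment> \<open>The residual tends to 0, so w is close to minus F at the nodes, hence close to
    minus g there.\<close>
  have small: "\<exists>N. \<forall>j\<ge>N. \<forall>k\<le>\<nu> (r j). \<bar>w (r j) k + g (node (\<nu> (r j)) k)\<bar> < e" if "0 < e" for e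
  proof -
    have e2: "0 < e / 2" using that by simp
    obtain N where N: "\<And>n x. n \<ge> N \<Longrightarrow> x \<in> {0..pi} \<Longrightarrow> \<bar>F (r n) x - g x\<bar> < e / 2"
      using conv[OF e2] unfolding real_norm_def by blast
    obtain N' where "inverse (real (Suc N')) < e / 2"
      using reals_Archimedean[OF e2] by blast
    then have N': "1 / (real N' + 1) < e / 2"
      by (simp add: inverse_eq_divide add.commute)
    have "\<bar>w (r j) k + g (node (\<nu> (r j)) k)\<bar> < e" if "max N N' \<le> j" "k \<le> \<nu> (r j)" for j k
    proof -
      have "N' \<le> r j" using that seq_suble[OF r, of j] by simp
      then have "1 / (real (r j) + 1) \<le> 1 / (real N' + 1)" by (intro divide_left_mono) auto
      have "\<bar>w (r j) k + g (node (\<nu> (r j)) k)\<bar> \<le> \<bar>w (r j) k + F (r j) (node (\<nu> (r j)) k)\<bar> + \<bar>F (r j) (node (\<nu> (r j)) k) - g (node (\<nu> (r j)) k)\<bar>"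
        by linarith
      also have "\<dots> < e / 2 + e / 2"
      proof (rule add_strict_mono)
        show "\<bar>w (r j) k + F (r j) (node (\<nu> (r j)) k)\<bar> < e / 2"
          using res[OF that(2)] N' \<open>1 / (real (r j) + 1) \<le> _\<close> unfolding F_def by (meson le_less_trans order_trans)
        show "\<bar>F (r j) (node (\<nu> (r j)) k) - g (node (\<nu> (r j)) k)\<bar> < e / 2"
          using that(1) by (intro N nd that(2)) simp
      qed
      finally show ?thesis by simp
    qed
    then show ?thesis by blast
  qed
  have lim: "filterlim (\<lambda>j. \<nu> (r j)) at_top sequentially"
    by (rule filterlim_at_top_mono[OF filterlim_ident])
      (intro always_eventually allI order_trans[OF seq_suble[OF r] \<nu>])
  have g0: "g t = 0" if "t \<in> {0..pi}" for t
  proof (rule inj[OF g _ that])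
    fix t assume t: "t \<in> {0..pi}"
    have "(\<lambda>n. ?Z n (\<lambda>k. g (node n k)) t) \<longlonglongrightarrow> cont_op h \<kappa>1 \<kappa>2 g t"
      unfolding disc_op_def cont_op_def
      using t by (intro tendsto_intros quad_tendsto continuous_on_mult g
        continuous_on_square_slice[OF \<kappa>1] continuous_on_square_slice[OF \<kappa>2]) auto
    then have "(\<lambda>j. ?Z (\<nu> (r j)) (\<lambda>k. g (node (\<nu> (r j)) k)) t) \<longlonglongrightarrow> cont_op h \<kappa>1 \<kappa>2 g t"
      by (rule filterlim_compose[OF _ lim])
    moreover have "(\<lambda>j. F (r j) t) \<longlonglongrightarrow> g t"
      using conv t unfolding LIMSEQ_iff by blast
    ultimately have "(\<lambda>j. F (r j) t + ?Z (\<nu> (r j)) (\<lambda>k. g (node (\<nu> (r j)) k)) t) \<longlonglongrightarrow> g t + cont_op h \<kappa>1 \<kappa>2 g t"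
      by (intro tendsto_add)
    \<comment> \<open>By linearity this is the discrete operator applied to w + g, which is
      uniformly small on the nodes.\<close>
    moreover have "(\<lambda>j. F (r j) t + ?Z (\<nu> (r j)) (\<lambda>k. g (node (\<nu> (r j)) k)) t) \<longlonglongrightarrow> 0"
    proof (rule LIMSEQ_I)
      fix e :: real assume "0 < e"
      then have "0 < e / (2 * C)" using C by simp
      then obtain N where N: "\<And>j k. N \<le> j \<Longrightarrow> k \<le> \<nu> (r j) \<Longrightarrow> \<bar>w (r j) k + g (node (\<nu> (r j)) k)\<bar> < e / (2 * C)"
        using small by blast
      have "\<bar>?Z (\<nu> (r j)) (\<lambda>k. w (r j) k + g (node (\<nu> (r j)) k)) t\<bar> \<le> C * (e / (2 * C))" if "N \<le> j" for j
        using N[OF that] by (intro C(2) t less_imp_le)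
      moreover have "C * (e / (2 * C)) < e" using C \<open>0 < e\<close> by simp
      ultimately show "\<exists>N. \<forall>j\<ge>N. norm (F (r j) t + ?Z (\<nu> (r j)) (\<lambda>k. g (node (\<nu> (r j)) k)) t - 0) < e"
        unfolding F_def disc_op_add[symmetric] by fastforce
    qed
    ultimately show "g t + cont_op h \<kappa>1 \<kappa>2 g t = 0" using LIMSEQ_unique by blast
  qed
  \<comment> \<open>With g = 0, the vector w would be below 1 in modulus at every node, against its
    normalisation.\<close>
  obtain N where N: "\<forall>k\<le>\<nu> (r N). \<bar>w (r N) k + g (node (\<nu> (r N)) k)\<bar> < 1"
    using small[of 1] by auto
  obtain i where i: "i \<le> \<nu> (r N)" "\<bar>w (r N) i\<bar> = 1" using w1 by blast
  then show False using N g0[OF nd[OF i(1)]] by auto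
qed

section \<open>Calculus and smoothing for functions of class $C^p$\<close>

text \<open>No induction is involved: for m > 0 the derivative witness of \<open>f\<close> serves
  for \<open>g\<close> unchanged, being constrained at points of \<open>S\<close> only.\<close>

lemma Cn_on_cong:
  assumes "Cn_on m S f" "\<And>x. x \<in> S \<Longrightarrow> g x = f x"
  shows "Cn_on m S g"
proof (cases m)
  case 0
  then show ?thesis using assms continuous_on_cong[of S S g f] by simp
next
  case (Suc m')
  then show ?thesis using assms by (auto intro: has_derivative_transform)
qed

lemma Cn_on_continuous: "Cn_on m S f \<Longrightarrow> continuous_on S f"
  by (cases m) (auto intro: has_derivative_continuous_on)

text \<open>Continuity is demanded only at the bottom of the recursion; stopping one level earlier
  uses that a differentiable function is continuous.\<close>

lemma Cn_on_SucD: "Cn_on (Suc m) S f \<Longrightarrow> Cn_on m S f"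
proof (induction m arbitrary: f)
  case 0
  then show ?case using Cn_on_continuous by (metis Cn_on.simps(1))
next
  case (Suc m)
  from Suc.prems show ?case
    unfolding Cn_on.simps(2)[of "Suc m"] Cn_on.simps(2)[of m S f] using Suc.IH by blast
qed

lemma Cn_on_le:
  assumes "Cn_on n S f" "m \<le> n"
  shows "Cn_on m S f"
  using assms(2,1) by (induction rule: inc_induct) (auto dest: Cn_on_SucD simp del: Cn_on.simps)

lemma Cn_on_const: "Cn_on m S (\<lambda>_. c)"
proof (induction m arbitrary: c)
  case (Suc m)
  then show ?case by (auto intro!: exI[of _ "\<lambda>_ _. 0"])
qed simp

lemma Cn_on_add: "Cn_on m S f \<Longrightarrow> Cn_on m S g \<Longrightarrow> Cn_on m S (\<lambda>x. f x + g x)"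
proof (induction m arbitrary: f g)
  case (Suc m)
  from Suc.prems obtain f' g' where
    "\<forall>x\<in>S. (f has_derivative f' x) (at x within S)" "\<forall>b\<in>Basis. Cn_on m S (\<lambda>x. f' x b)"
    "\<forall>x\<in>S. (g has_derivative g' x) (at x within S)" "\<forall>b\<in>Basis. Cn_on m S (\<lambda>x. g' x b)"
    by auto
  then show ?case
    by (auto intro!: exI[of _ "\<lambda>x h. f' x h + g' x h"] Suc.IH has_derivative_add)
qed (auto intro: continuous_on_add)

lemma Cn_on_mult: "Cn_on m S f \<Longrightarrow> Cn_on m S g \<Longrightarrow> Cn_on m S (\<lambda>x. f x * g x)"
proof (induction m arbitrary: f g)
  case (Suc m)
  from Suc.prems obtain f' g' where
    "\<forall>x\<in>S. (f has_derivative f' x) (at x within S)" "\<forall>b\<in>Basis. Cn_on m S (\<lambda>x. f' x b)"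
    "\<forall>x\<in>S. (g has_derivative g' x) (at x within S)" "\<forall>b\<in>Basis. Cn_on m S (\<lambda>x. g' x b)"
    by auto
  moreover have "Cn_on m S f" "Cn_on m S g" using Suc.prems by (blast dest: Cn_on_SucD)+
  ultimately show ?case
    by (auto intro!: exI[of _ "\<lambda>x h. f x * g' x h + f' x h * g x"] Suc.IH Cn_on_add has_derivative_mult)
qed (auto intro: continuous_on_mult)

lemma Cn_on_cmult: "Cn_on m S f \<Longrightarrow> Cn_on m S (\<lambda>x. c * f x)"
  by (intro Cn_on_mult Cn_on_const)

lemma Cn_on_diff:
  assumes "Cn_on m S f" "Cn_on m S g"
  shows "Cn_on m S (\<lambda>x. f x - g x)"
  using Cn_on_add[OF assms(1) Cn_on_cmult[OF assms(2), of "-1"]] by simp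

lemma Cn_on_sum: "(\<And>i. i \<in> A \<Longrightarrow> Cn_on m S (f i)) \<Longrightarrow> Cn_on m S (\<lambda>x. \<Sum>i\<in>A. f i x)"
  by (induction A rule: infinite_finite_induct) (auto intro: Cn_on_const Cn_on_add)

text \<open>This much of the chain rule covers the coordinate swap, the diagonal and the projection.
  The direction \<open>L b\<close> is in general no basis vector, but its expansion in the basis has
  coefficients independent of x, so no derivatives of an inner function appear.\<close>

lemma Cn_on_affine_comp:
  fixes L :: "'b::euclidean_space \<Rightarrow> 'a::euclidean_space"
  assumes "bounded_linear L" and T: "\<And>x. x \<in> T \<Longrightarrow> c + L x \<in> S" and "Cn_on m S f"
  shows "Cn_on m T (\<lambda>x. f (c + L x))"
  using assms(3)
proof (induction m arbitrary: f)
  case 0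
  have "continuous_on T (\<lambda>x. c + L x)"
    by (intro continuous_intros bounded_linear.continuous_on[OF assms(1)])
  then show ?case using 0 T by (auto intro: continuous_on_compose2)
next
  case (Suc m)
  interpret L: bounded_linear L by fact
  from Suc.prems obtain f' where f': "\<And>x. x \<in> S \<Longrightarrow> (f has_derivative f' x) (at x within S)"
    and C: "\<And>b. b \<in> Basis \<Longrightarrow> Cn_on m S (\<lambda>x. f' x b)"
    by auto
  have "((\<lambda>x. f (c + L x)) has_derivative (\<lambda>h. f' (c + L x) (L h))) (at x within T)" if "x \<in> T" for x
    by (rule has_derivative_in_compose2[where t = S and g = f and f = "\<lambda>x. c + L x"])
      (use f' T that in \<open>auto intro!: derivative_eq_intros L.has_derivative\<close>)
  moreover have "Cn_on m T (\<lambda>x. f' (c + L x) (L b))" for b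
  proof (rule Cn_on_cong)
    show "Cn_on m T (\<lambda>x. \<Sum>i\<in>Basis. (L b \<bullet> i) * f' (c + L x) i)"
      by (intro Cn_on_sum Cn_on_cmult Suc.IH C)
    show "f' (c + L x) (L b) = (\<Sum>i\<in>Basis. (L b \<bullet> i) * f' (c + L x) i)" if "x \<in> T" for x
    proof -
      have "linear (f' (c + L x))"
        using f'[OF T[OF that]] has_derivative_linear by blast
      then have "f' (c + L x) (\<Sum>i\<in>Basis. (L b \<bullet> i) *\<^sub>R i) = (\<Sum>i\<in>Basis. (L b \<bullet> i) * f' (c + L x) i)"
        by (simp add: linear_sum linear_cmul)
      then show ?thesis by (simp add: euclidean_representation)
    qed
  qed
  ultimately show ?case
    unfolding Cn_on.simps by (intro exI[of _ "\<lambda>x h. f' (c + L x) (L h)"]) blast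
qed

lemma Cn_on_SucI_real:
  fixes f :: "real \<Rightarrow> real"
  assumes "\<And>x. x \<in> S \<Longrightarrow> (f has_real_derivative f' x) (at x within S)" "Cn_on m S f'"
  shows "Cn_on (Suc m) S f"
  using assms by (auto intro!: exI[of _ "\<lambda>x h. f' x * h"] simp: has_field_derivative_def)

section \<open>Partial derivatives and integrals depending on a parameter\<close>

lemma Cn_on_partial_fst:
  fixes k :: "real \<Rightarrow> real \<Rightarrow> real"
  assumes "Cn_on (Suc m) (A \<times> B) (\<lambda>(t, s). k t s)"
  obtains kt where "Cn_on m (A \<times> B) (\<lambda>(t, s). kt t s)"
    "\<And>t s. t \<in> A \<Longrightarrow> s \<in> B \<Longrightarrow> ((\<lambda>t. k t s) has_real_derivative kt t s) (at t within A)"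
proof -
  obtain f' where f': "\<And>x. x \<in> A \<times> B \<Longrightarrow> ((\<lambda>(t, s). k t s) has_derivative f' x) (at x within A \<times> B)"
    and C: "\<And>b. b \<in> Basis \<Longrightarrow> Cn_on m (A \<times> B) (\<lambda>x. f' x b)"
    using assms by auto
  show ?thesis
  proof (rule that[of "\<lambda>t s. f' (t, s) (1, 0)"])
    have "(1, 0) \<in> (Basis :: (real \<times> real) set)" by (simp add: Basis_prod_def)
    then show "Cn_on m (A \<times> B) (\<lambda>(t, s). f' (t, s) (1, 0))"
      using C[of "(1, 0)"] by (simp add: case_prod_unfold)
    fix t s assume ts: "t \<in> A" "s \<in> B"
    have "((\<lambda>t. (\<lambda>(t, s). k t s) (t, s)) has_derivative (\<lambda>h. f' (t, s) (h, 0))) (at t within A)"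
      by (rule has_derivative_in_compose2[where t = "A \<times> B" and g = "\<lambda>(t, s). k t s" and f = "\<lambda>t. (t, s)"])
        (use f' ts in \<open>auto intro!: derivative_eq_intros\<close>)
    moreover have "h * f' (t, s) (1, 0) = f' (t, s) (h, 0)" for h
    proof -
      have "linear (f' (t, s))" using f'[of "(t, s)"] ts has_derivative_linear by blast
      then have "f' (t, s) (h *\<^sub>R (1, 0)) = h *\<^sub>R f' (t, s) (1, 0)" by (rule linear_cmul)
      then show ?thesis by simp
    qed
    ultimately show "((\<lambda>t. k t s) has_real_derivative f' (t, s) (1, 0)) (at t within A)"
      by (intro has_derivative_imp_has_field_derivative[where D = "\<lambda>h. f' (t, s) (h, 0)"]) auto
  qed
qed

lemma Cn_on_swap:
  fixes k :: "real \<Rightarrow> real \<Rightarrow> real"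
  assumes "Cn_on m (A \<times> B) (\<lambda>(t, s). k t s)"
  shows "Cn_on m (B \<times> A) (\<lambda>(s, t). k t s)"
proof -
  have "bounded_linear (\<lambda>x :: real \<times> real. (snd x, fst x))"
    by (intro bounded_linear_Pair bounded_linear_snd bounded_linear_fst)
  from Cn_on_affine_comp[OF this _ assms, of "B \<times> A" 0] show ?thesis
    by (auto simp: case_prod_unfold)
qed

lemma Cn_on_partial_snd:
  fixes k :: "real \<Rightarrow> real \<Rightarrow> real"
  assumes "Cn_on (Suc m) (A \<times> B) (\<lambda>(t, s). k t s)"
  obtains ks where "Cn_on m (A \<times> B) (\<lambda>(t, s). ks t s)"
    "\<And>t s. t \<in> A \<Longrightarrow> s \<in> B \<Longrightarrow> (k t has_real_derivative ks t s) (at s within B)"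
proof -
  obtain ks where ks: "Cn_on m (B \<times> A) (\<lambda>(s, t). ks s t)"
    "\<And>s t. s \<in> B \<Longrightarrow> t \<in> A \<Longrightarrow> ((\<lambda>s. k t s) has_real_derivative ks s t) (at s within B)"
    by (rule Cn_on_partial_fst[OF Cn_on_swap[OF assms]]) blast
  show ?thesis
    by (rule that[of "\<lambda>t s. ks s t"]) (use ks(2) Cn_on_swap[OF ks(1)] in auto)
qed

text \<open>Produces the chain of s-derivatives in the form that \<open>cheb_approx\<close> takes;
  joint continuity of the last one gives a bound uniform in t.\<close>

lemma Cn_on_partial_snd_iterate:
  fixes k :: "real \<Rightarrow> real \<Rightarrow> real"
  assumes "Cn_on m (A \<times> B) (\<lambda>(t, s). k t s)"
  obtains D :: "nat \<Rightarrow> real \<Rightarrow> real \<Rightarrow> real" where "D 0 = k" "continuous_on (A \<times> B) (\<lambda>(t, s). D m t s)"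
    "\<And>i t s. i < m \<Longrightarrow> t \<in> A \<Longrightarrow> s \<in> B \<Longrightarrow> (D i t has_real_derivative D (Suc i) t s) (at s within B)"
  using assms
proof (induction m arbitrary: k thesis)
  case 0
  show ?case by (rule 0(1)[of "\<lambda>_. k"]) (use 0(2) in auto)
next
  case (Suc m)
  obtain ks where ks: "Cn_on m (A \<times> B) (\<lambda>(t, s). ks t s)"
    "\<And>t s. t \<in> A \<Longrightarrow> s \<in> B \<Longrightarrow> (k t has_real_derivative ks t s) (at s within B)"
    by (rule Cn_on_partial_snd[OF Suc.prems(2)]) blast
  obtain D where D: "D 0 = ks" "continuous_on (A \<times> B) (\<lambda>(t, s). D m t s)"
    "\<And>i t s. i < m \<Longrightarrow> t \<in> A \<Longrightarrow> s \<in> B \<Longrightarrow> (D i t has_real_derivative D (Suc i) t s) (at s within B)"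
    by (rule Suc.IH[OF _ ks(1)]) blast
  show ?case
    by (rule Suc.prems(1)[of "case_nat k D"]) (use D ks(2) in \<open>auto split: nat.split\<close>)
qed

lemma Cn_on_diag:
  fixes k :: "real \<Rightarrow> real \<Rightarrow> real"
  assumes "Cn_on m (A \<times> A) (\<lambda>(t, s). k t s)"
  shows "Cn_on m A (\<lambda>t. k t t)"
proof -
  have "bounded_linear (\<lambda>x :: real. (x, x))"
    by (intro bounded_linear_Pair bounded_linear_ident)
  from Cn_on_affine_comp[OF this _ assms, of A 0] show ?thesis by auto
qed

lemma Cn_on_snd:
  fixes x :: "real \<Rightarrow> real" and A :: "real set"
  assumes "Cn_on m B x"
  shows "Cn_on m (A \<times> B) (\<lambda>(t, s). x s)"
proof -
  have "bounded_linear (snd :: real \<times> real \<Rightarrow> real)" by (rule bounded_linear_snd)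
  from Cn_on_affine_comp[OF this _ assms, of "A \<times> B" 0] show ?thesis
    by (auto simp: case_prod_unfold)
qed

lemma continuous_on_kernel_mult:
  fixes k :: "real \<Rightarrow> real \<Rightarrow> real"
  assumes "continuous_on (A \<times> B) (\<lambda>(t, s). k t s)" "continuous_on B x"
  shows "continuous_on (A \<times> B) (\<lambda>(t, s). k t s * x s)"
  using Cn_on_mult[of 0 "A \<times> B" "\<lambda>(t, s). k t s" "\<lambda>(t, s). x s"] Cn_on_snd[of 0 B x A] assms
  by (simp add: case_prod_unfold)

text \<open>All dependence on t sits in the kernel, so differentiation under the integral sign never
  touches \<open>x\<close>, and its continuity suffices.\<close>

lemma Cn_on_integral_fixed:
  fixes k :: "real \<Rightarrow> real \<Rightarrow> real"
  assumes "Cn_on m ({a..b} \<times> {c..d}) (\<lambda>(t, s). k t s)" "continuous_on {c..d} x"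
  shows "Cn_on m {a..b} (\<lambda>t. integral {c..d} (\<lambda>s. k t s * x s))"
  using assms
proof (induction m arbitrary: k)
  case 0
  then have "continuous_on ({a..b} \<times> {c..d}) (\<lambda>(t, s). k t s * x s)"
    by (intro continuous_on_kernel_mult) auto
  then show ?case using integral_continuous_on_param[of "{a..b}" c d "\<lambda>t s. k t s * x s"] by simp
next
  case (Suc m)
  obtain kt where kt: "Cn_on m ({a..b} \<times> {c..d}) (\<lambda>(t, s). kt t s)"
    "\<And>t s. t \<in> {a..b} \<Longrightarrow> s \<in> {c..d} \<Longrightarrow> ((\<lambda>t. k t s) has_real_derivative kt t s) (at t within {a..b})"
    by (rule Cn_on_partial_fst[OF Suc.prems(1)]) blast
  note ck = continuous_on_kernel_mult[OF Cn_on_continuous[OF Suc.prems(1)] Suc.prems(2)]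
  note ckt = continuous_on_kernel_mult[OF Cn_on_continuous[OF kt(1)] Suc.prems(2)]
  show ?case
  proof (rule Cn_on_SucI_real)
    show "Cn_on m {a..b} (\<lambda>t. integral {c..d} (\<lambda>s. kt t s * x s))"
      by (rule Suc.IH[OF kt(1) Suc.prems(2)])
    fix t assume t: "t \<in> {a..b}"
    have "((\<lambda>t. integral (cbox c d) (\<lambda>s. k t s * x s)) has_real_derivative integral (cbox c d) (\<lambda>s. kt t s * x s)) (at t within {a..b})"
      by (rule leibniz_rule_field_derivative)
        (use kt(2) ckt t continuous_on_square_slice[OF ck] in
          \<open>auto intro!: DERIV_cmult_right integrable_continuous_real\<close>)
    then show "((\<lambda>t. integral {c..d} (\<lambda>s. k t s * x s)) has_real_derivative integral {c..d} (\<lambda>s. kt t s * x s)) (at t within {a..b})"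
      by simp
  qed
qed

text \<open>The substitution s = a + (t - a) u moves the variable limit into the integrand, over the
  fixed interval [0, 1].\<close>

lemma continuous_on_integral_left:
  fixes f :: "real \<Rightarrow> real \<Rightarrow> real"
  assumes f: "continuous_on ({a..b} \<times> {a..b}) (\<lambda>(t, s). f t s)"
  shows "continuous_on {a..b} (\<lambda>t. integral {a..t} (f t))"
proof -
  have "continuous_on ({a..b} \<times> {0..1}) (\<lambda>x. (\<lambda>(t, s). f t s) (fst x, a + (fst x - a) * snd x))"
  proof (rule continuous_on_compose2[OF f])
    have "a + (t - a) * u \<in> {a..b}" if "t \<in> {a..b}" "u \<in> {0..1}" for t u
      using that mult_left_le[of u "t - a"] by auto
    then show "(\<lambda>x. (fst x, a + (fst x - a) * snd x)) ` ({a..b} \<times> {0..1}) \<subseteq> {a..b} \<times> {a..b}"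
      by auto
  qed (intro continuous_intros)
  then have "continuous_on ({a..b} \<times> cbox 0 1) (\<lambda>(t, u). (t - a) * f t (a + (t - a) * u))"
    by (auto intro!: continuous_intros simp: case_prod_unfold)
  then have c: "continuous_on {a..b} (\<lambda>t. integral (cbox 0 1) (\<lambda>u. (t - a) * f t (a + (t - a) * u)))"
    by (rule integral_continuous_on_param)
  have eq: "integral {a..t} (f t) = integral (cbox 0 1) (\<lambda>u. (t - a) * f t (a + (t - a) * u))" if t: "t \<in> {a..b}" for t
  proof -
    have "((\<lambda>u. (t - a) *\<^sub>R f t (a + (t - a) * u)) has_integral integral {a + (t - a) * 0..a + (t - a) * 1} (f t)) {0..1}"
    proof (rule has_integral_substitution[where c = a and d = t])
      have "a + (t - a) * u \<le> t" if "u \<in> {0..1}" for u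
        using that t mult_left_le[of u "t - a"] by auto
      then show "(\<lambda>u. a + (t - a) * u) ` {0..1} \<subseteq> {a..t}" using t by auto
      show "continuous_on {a..t} (f t)"
        by (rule continuous_on_subset[OF continuous_on_square_slice[OF f t]]) (use t in auto)
    qed (use t in \<open>auto intro!: derivative_eq_intros\<close>)
    from integral_unique[OF this] show ?thesis by simp
  qed
  show ?thesis by (rule continuous_on_eq[OF c]) (simp only: eq)
qed

text \<open>Leibniz rule with a moving limit: the integral is viewed as a function of the parameter
  t and the upper limit u, differentiated partially in each, and restricted to the diagonal u =
  t.\<close>

lemma integral_left_has_derivative:
  fixes f ft :: "real \<Rightarrow> real \<Rightarrow> real"
  assumes f: "continuous_on ({a..b} \<times> {a..b}) (\<lambda>(t, s). f t s)"
    and ft: "continuous_on ({a..b} \<times> {a..b}) (\<lambda>(t, s). ft t s)"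
    and deriv: "\<And>t s. t \<in> {a..b} \<Longrightarrow> s \<in> {a..b} \<Longrightarrow> ((\<lambda>t. f t s) has_real_derivative ft t s) (at t within {a..b})"
    and t: "t \<in> {a..b}"
  shows "((\<lambda>t. integral {a..t} (f t)) has_real_derivative f t t + integral {a..t} (ft t)) (at t within {a..b})"
proof -
  let ?\<Phi> = "\<lambda>(t, u). integral {a..u} (f t)"
  have "(?\<Phi> has_derivative (\<lambda>(h1, h2). integral {a..t} (ft t) * h1 + blinfun_apply (blinfun_mult_right (f t t)) h2))
      (at (t, t) within {a..b} \<times> {a..b})"
  proof (rule has_derivative_partialsI[where fy = "\<lambda>t u. blinfun_mult_right (f t u)"])
    have "((\<lambda>t'. integral (cbox a t) (f t')) has_real_derivative integral (cbox a t) (ft t)) (at t within {a..b})"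
    proof (rule leibniz_rule_field_derivative)
      show "f x integrable_on cbox a t" if "x \<in> {a..b}" for x
        using continuous_on_subset[OF continuous_on_square_slice[OF f that], of "{a..t}"] t
        by (auto intro!: integrable_continuous_real)
      show "continuous_on ({a..b} \<times> cbox a t) (\<lambda>(x, t). ft x t)"
        by (rule continuous_on_subset[OF ft]) (use t in auto)
    qed (use deriv t in auto)
    then show "((\<lambda>t'. integral {a..t} (f t')) has_derivative (*) (integral {a..t} (ft t))) (at t within {a..b})"
      by (simp add: has_field_derivative_def)
    show "((\<lambda>u. integral {a..u} (f t')) has_derivative blinfun_apply (blinfun_mult_right (f t' u))) (at u within {a..b})"
      if "t' \<in> {a..b}" "u \<in> {a..b}" for t' u
      using integral_has_real_derivative[OF continuous_on_square_slice[OF f that(1)] that(2)]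
      by (simp add: has_field_derivative_def)
    have "continuous_on ({a..b} \<times> {a..b}) (\<lambda>x. blinfun_mult_right ((\<lambda>(t, s). f t s) x))"
      by (intro bounded_linear.continuous_on[OF bounded_linear_blinfun_mult_right] f)
    then show "continuous (at (t, t) within {a..b} \<times> {a..b}) (\<lambda>(t, u). blinfun_mult_right (f t u))"
      using t by (auto simp: continuous_on_eq_continuous_within case_prod_unfold)
  qed (use t in auto)
  then have "(?\<Phi> has_derivative (\<lambda>(h1, h2). integral {a..t} (ft t) * h1 + f t t * h2))
      (at (t, t) within {a..b} \<times> {a..b})"
    by simp
  then have "(?\<Phi> has_derivative (\<lambda>(h1, h2). integral {a..t} (ft t) * h1 + f t t * h2))
      (at (t, t) within (\<lambda>t. (t, t)) ` {a..b})"
    by (rule has_derivative_subset) auto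
  then have "((\<lambda>t. ?\<Phi> (t, t)) has_derivative (\<lambda>h. (\<lambda>(h1, h2). integral {a..t} (ft t) * h1 + f t t * h2) (h, h))) (at t within {a..b})"
    by (rule has_derivative_in_compose[where f = "\<lambda>t. (t, t)", rotated])
      (intro has_derivative_Pair has_derivative_ident)
  then have "((\<lambda>t. integral {a..t} (f t)) has_derivative (\<lambda>h. integral {a..t} (ft t) * h + f t t * h)) (at t within {a..b})"
    by (simp only: prod.case)
  then show ?thesis
    by (rule has_derivative_imp_has_field_derivative) (simp add: algebra_simps)
qed

text \<open>Integration gains one derivative over \<open>x\<close>; this gain drives the bootstrap
  for null functions. At m = 0 the subtraction truncates and the hypothesis on \<open>x\<close> is
  continuity.\<close>

lemma Cn_on_integral_left:
  fixes k :: "real \<Rightarrow> real \<Rightarrow> real"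
  assumes "Cn_on m ({a..b} \<times> {a..b}) (\<lambda>(t, s). k t s)" "Cn_on (m - 1) {a..b} x"
  shows "Cn_on m {a..b} (\<lambda>t. integral {a..t} (\<lambda>s. k t s * x s))"
  using assms
proof (induction m arbitrary: k)
  case 0
  then have "continuous_on ({a..b} \<times> {a..b}) (\<lambda>(t, s). k t s * x s)"
    by (intro continuous_on_kernel_mult) auto
  then show ?case using continuous_on_integral_left by simp
next
  case (Suc m)
  have x: "continuous_on {a..b} x" using Suc.prems(2) by (rule Cn_on_continuous)
  obtain kt where kt: "Cn_on m ({a..b} \<times> {a..b}) (\<lambda>(t, s). kt t s)"
    "\<And>t s. t \<in> {a..b} \<Longrightarrow> s \<in> {a..b} \<Longrightarrow> ((\<lambda>t. k t s) has_real_derivative kt t s) (at t within {a..b})"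
    by (rule Cn_on_partial_fst[OF Suc.prems(1)]) blast
  note ck = continuous_on_kernel_mult[OF Cn_on_continuous[OF Suc.prems(1)] x]
  note ckt = continuous_on_kernel_mult[OF Cn_on_continuous[OF kt(1)] x]
  show ?case
  proof (rule Cn_on_SucI_real)
    show "Cn_on m {a..b} (\<lambda>t. k t t * x t + integral {a..t} (\<lambda>s. kt t s * x s))"
    proof (intro Cn_on_add Cn_on_mult)
      show "Cn_on m {a..b} (\<lambda>t. k t t)"
        by (rule Cn_on_diag[OF Cn_on_SucD[OF Suc.prems(1)]])
      show x': "Cn_on m {a..b} x" using Suc.prems(2) by simp
      show "Cn_on m {a..b} (\<lambda>t. integral {a..t} (\<lambda>s. kt t s * x s))"
        by (rule Suc.IH[OF kt(1) Cn_on_le[OF x']]) simp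
    qed
    show "((\<lambda>t. integral {a..t} (\<lambda>s. k t s * x s)) has_real_derivative k t t * x t + integral {a..t} (\<lambda>s. kt t s * x s)) (at t within {a..b})"
      if "t \<in> {a..b}" for t
      by (rule integral_left_has_derivative[OF ck ckt _ that]) (use kt(2) in \<open>auto intro!: DERIV_cmult_right\<close>)
  qed
qed

text \<open>Bootstrap: a null function equals minus its integrals, which are one degree smoother as
  long as the kernels permit. The integral from t to b is the full integral minus the one from a to
  t, so only left integrals have a moving limit.\<close>

lemma integral_op_null_smooth:
  fixes k1 k2 :: "real \<Rightarrow> real \<Rightarrow> real"
  assumes "Cn_on m ({a..b} \<times> {a..b}) (\<lambda>(t, s). k1 t s)" "Cn_on m ({a..b} \<times> {a..b}) (\<lambda>(t, s). k2 t s)"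
    and x: "continuous_on {a..b} x" and null: "\<And>t. t \<in> {a..b} \<Longrightarrow> integral_op a b k1 k2 x t = 0"
  shows "Cn_on m {a..b} x"
  using assms(1,2)
proof (induction m)
  case 0
  then show ?case using x by simp
next
  case (Suc m)
  have IH: "Cn_on m {a..b} x"
    using Suc by (blast dest: Cn_on_SucD)
  show ?case
  proof (rule Cn_on_cong)
    show "Cn_on (Suc m) {a..b} (\<lambda>t. (integral {a..t} (\<lambda>s. k2 t s * x s) - integral {a..t} (\<lambda>s. k1 t s * x s)) - integral {a..b} (\<lambda>s. k2 t s * x s))"
      using Suc.prems IH x
      by (intro Cn_on_diff Cn_on_integral_left Cn_on_integral_fixed) (simp_all del: Cn_on.simps)
    fix t assume t: "t \<in> {a..b}"
    have "continuous_on {a..b} (\<lambda>s. k2 t s * x s)"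
      using continuous_on_square_slice[OF Cn_on_continuous[OF Suc.prems(2)] t] by (intro continuous_intros x)
    then have "integral {a..t} (\<lambda>s. k2 t s * x s) + integral {t..b} (\<lambda>s. k2 t s * x s) = integral {a..b} (\<lambda>s. k2 t s * x s)"
      using t by (intro Henstock_Kurzweil_Integration.integral_combine) (auto intro!: integrable_continuous_real)
    then show "x t = (integral {a..t} (\<lambda>s. k2 t s * x s) - integral {a..t} (\<lambda>s. k1 t s * x s)) - integral {a..b} (\<lambda>s. k2 t s * x s)"
      using null[OF t] by (simp add: integral_op_def)
  qed
qed

section \<open>The matrices in trigonometric form\<close>

text \<open>\<open>mat_inverse\<close> returns an option; a left inverse of a square matrix is
  two-sided, which excludes \<open>None\<close> and determines the value.\<close>

lemma mat_inv_eq: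
  assumes A: "A \<in> carrier_mat n n" and B: "B \<in> carrier_mat n n" and BA: "B * A = 1\<^sub>m n"
  shows "mat_inv A = B"
proof (cases "mat_inverse A")
  case None
  have "A * B = 1\<^sub>m n" by (rule mat_mult_left_right_inverse[OF B A BA])
  then have "A \<in> Units (ring_mat TYPE(real) n ())"
    using A B BA unfolding Units_def by (auto simp: ring_mat_def)
  then show ?thesis using mat_inverse(1)[OF A None, where b = "()"] by blast
next
  case (Some X)
  have X: "A * X = 1\<^sub>m n" "X \<in> carrier_mat n n" using mat_inverse(2)[OF A Some] by auto
  have "X = (B * A) * X" using X BA by simp
  also have "\<dots> = B * (A * X)" using A B X by (intro assoc_mult_mat) auto
  also have "\<dots> = B" using X B by simp
  finally show ?thesis using Some by (simp add: mat_inv_def)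
qed

lemma mult_mat_vec_fun:
  assumes "i \<le> n"
  shows "vec_index (Matrix.mat (n + 1) (n + 1) A *\<^sub>v Matrix.vec (n + 1) v) i = (\<Sum>j\<le>n. A (i, j) * v j)"
  using assms by (simp add: scalar_prod_def atLeast0LessThan lessThan_Suc_atMost)

lemma mult_mat_vec_fun_eq:
  "Matrix.mat (n + 1) (n + 1) A *\<^sub>v Matrix.vec (n + 1) v = Matrix.vec (n + 1) (\<lambda>i. \<Sum>j\<le>n. A (i, j) * v j)"
  by (rule eq_vecI) (simp_all add: scalar_prod_def atLeast0LessThan lessThan_Suc_atMost)

lemma cheb_tau: "k \<le> n \<Longrightarrow> cheb j (tau n k) = cos (real j * node n k)"
  using node_bounds[of k n] unfolding cheb_def tau_def node_def[symmetric] by (simp add: arccos_cos)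

text \<open>Discrete orthogonality: entry (l, j) of the product is the l-th interpolation
  coefficient of cos (j t).\<close>

lemma mat_inv_C_mat:
  "mat_inv (C_mat n) = Matrix.mat (n + 1) (n + 1) (\<lambda>(l, k). (if l = 0 then 1 else 2) / (real n + 1) * cos (real l * node n k))"
    (is "_ = ?D")
proof (rule mat_inv_eq)
  show "?D * C_mat n = 1\<^sub>m (n + 1)"
  proof (rule eq_matI)
    fix l j assume "l < dim_row (1\<^sub>m (n + 1) :: real Matrix.mat)" "j < dim_col (1\<^sub>m (n + 1) :: real Matrix.mat)"
    then have lj: "l \<le> n" "j \<le> n" by auto
    have "(?D * C_mat n) $$ (l, j) = (\<Sum>k\<le>n. (if l = 0 then 1 else 2) / (real n + 1) * cos (real l * node n k) * cheb j (tau n k))"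
      using lj by (simp add: C_mat_def scalar_prod_def atLeast0LessThan lessThan_Suc_atMost)
    also have "\<dots> = coef n (\<lambda>k. cos (real j * node n k)) l"
      unfolding coef_def sum_distrib_left by (intro sum.cong refl) (simp add: cheb_tau)
    also have "\<dots> = 1\<^sub>m (n + 1) $$ (l, j)" using lj by (simp add: coef_cos)
    finally show "(?D * C_mat n) $$ (l, j) = 1\<^sub>m (n + 1) $$ (l, j)" .
  qed (auto simp: C_mat_def)
qed (auto simp: C_mat_def)

lemma C_mat_carrier: "C_mat n \<in> carrier_mat (n + 1) (n + 1)"
  by (simp add: C_mat_def)

lemma mat_inv_C_mat_carrier: "mat_inv (C_mat n) \<in> carrier_mat (n + 1) (n + 1)"
  by (simp add: mat_inv_C_mat)

lemma W_mat_carrier: "W_mat n \<in> carrier_mat (n + 1) (n + 1)"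
  unfolding W_mat_def
  by (intro mult_carrier_mat[of _ _ "n + 1"] C_mat_carrier mat_inv_C_mat_carrier) (auto simp: PL_mat_def B_mat_def)

lemma V_mat_carrier: "V_mat n \<in> carrier_mat (n + 1) (n + 1)"
  unfolding V_mat_def
  by (intro mult_carrier_mat[of _ _ "n + 1"] C_mat_carrier mat_inv_C_mat_carrier) (auto simp: PR_mat_def B_mat_def)

lemma mat_inv_C_mat_mult:
  "mat_inv (C_mat n) *\<^sub>v Matrix.vec (n + 1) g = Matrix.vec (n + 1) (coef n g)"
  unfolding mat_inv_C_mat mult_mat_vec_fun_eq
  by (rule eq_vecI) (simp_all add: coef_def sum_distrib_left algebra_simps)

definition B_entry :: "nat \<Rightarrow> nat \<Rightarrow> real" where
  "B_entry i j = (if i = 0 then 0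
     else if i = 1 then (if j = 0 then 1 else if j = 2 then - 1 / 2 else 0)
     else if j + 1 = i then 1 / (2 * real i)
     else if j = i + 1 then - 1 / (2 * real i)
     else 0)"

text \<open>Column \<open>l\<close> of \<open>B\<close> holds the cosine coefficients of \<open>anti l\<close>; the truncation only
  removes the term of degree \<open>n + 1\<close>, which vanishes at the nodes.\<close>

lemma B_entry_column:
  assumes l: "l \<le> n" and n: "1 \<le> n"
  shows "(\<Sum>j\<le>n. B_entry j l * cos (real j * t)) =
    anti l t - (if l = n then cos ((real n + 1) * t) / (2 * (real n + 1)) else 0)"
proof -
  \<comment> \<open>The entries are defined by rows; column l meets only the rows l + 1 and l - 1.
    The guard \<open>2 \<le> l\<close> excludes the truncated subtraction at l = 0 and, for l = 1,
    the zero row.\<close>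
  have B: "B_entry j l = (if j = l + 1 then (if l = 0 then 1 else 1 / (2 * real (l + 1))) else 0)
     - (if j = l - 1 then (if 2 \<le> l then 1 / (2 * real (l - 1)) else 0) else 0)" for j
  proof -
    consider "j = l + 1" | "l = j + 1" "1 \<le> j" | "j \<noteq> l + 1" "\<not> (l = j + 1 \<and> 1 \<le> j)"
      by blast
    then show ?thesis
    proof cases
      case 1
      then show ?thesis by (cases "l = 0") (simp_all add: B_entry_def)
    next
      case 2
      then show ?thesis by (cases "j = 1") (simp_all add: B_entry_def)
    next
      case 3
      then have "B_entry j l = 0" by (auto simp: B_entry_def)
      moreover have "\<not> (j = l - 1 \<and> 2 \<le> l)" using 3 by auto
      ultimately show ?thesis using 3 by auto
    qed
  qed
  have "(\<Sum>j\<le>n. B_entry j l * cos (real j * t)) =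
     (\<Sum>j\<le>n. if j = l + 1 then (if l = 0 then 1 else 1 / (2 * real (l + 1))) * cos (real j * t) else 0)
     - (\<Sum>j\<le>n. if j = l - 1 then (if 2 \<le> l then 1 / (2 * real (l - 1)) else 0) * cos (real j * t) else 0)"
    unfolding B sum_subtractf[symmetric] by (intro sum.cong refl) auto
  also have "\<dots> = (if l + 1 \<le> n then (if l = 0 then 1 else 1 / (2 * real (l + 1))) * cos (real (l + 1) * t) else 0)
     - (if 2 \<le> l then 1 / (2 * real (l - 1)) else 0) * cos (real (l - 1) * t)"
    using l by (simp add: sum.delta)
  also have "\<dots> = anti l t - (if l = n then cos ((real n + 1) * t) / (2 * (real n + 1)) else 0)"
  proof (cases "2 \<le> l")
    case True
    then have "real (l - 1) = real l - 1" by simp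
    then show ?thesis using l True by (cases "l = n") (auto simp: anti_def add.commute)
  next
    case False
    then consider "l = 0" | "l = 1" by linarith
    then show ?thesis using l n by cases (cases "n = 1"; auto simp: anti_def)+
  qed
  finally show ?thesis .
qed

lemma B_entry_sum:
  assumes n: "1 \<le> n"
  shows "(\<Sum>j\<le>n. (\<Sum>l\<le>n. B_entry j l * c l) * cos (real j * t)) =
    (\<Sum>l\<le>n. c l * anti l t) - c n * cos ((real n + 1) * t) / (2 * (real n + 1))"
proof -
  have "(\<Sum>j\<le>n. (\<Sum>l\<le>n. B_entry j l * c l) * cos (real j * t)) = (\<Sum>l\<le>n. \<Sum>j\<le>n. c l * (B_entry j l * cos (real j * t)))"
    unfolding sum_distrib_right by (subst sum.swap) (simp add: mult_ac)
  also have "\<dots> = (\<Sum>l\<le>n. c l * (anti l t - (if l = n then cos ((real n + 1) * t) / (2 * (real n + 1)) else 0)))"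
    unfolding sum_distrib_left[symmetric] using B_entry_column[OF _ n] by (intro sum.cong refl) simp
  also have "\<dots> = (\<Sum>l\<le>n. c l * anti l t) - (\<Sum>l\<le>n. if l = n then c l * (cos ((real n + 1) * t) / (2 * (real n + 1))) else 0)"
    unfolding sum_subtractf[symmetric] by (intro sum.cong refl) (auto simp: right_diff_distrib)
  finally show ?thesis by simp
qed

lemma quad_B_entry:
  assumes "1 \<le> n"
  shows "quad n \<alpha> (node n i) g =
    (\<Sum>j\<le>n. (\<Sum>l\<le>n. B_entry j l * coef n g l) * cos (real j * node n i))
    - (\<Sum>j\<le>n. (\<Sum>l\<le>n. B_entry j l * coef n g l) * cos (real j * \<alpha>))"
  unfolding B_entry_sum[OF assms] cos_node_last quad_def
  by (simp add: right_diff_distrib sum_subtractf)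

lemma B_mat_mult:
  "B_mat n *\<^sub>v Matrix.vec (n + 1) c = Matrix.vec (n + 1) (\<lambda>j. \<Sum>l\<le>n. B_entry j l * c l)"
  unfolding B_mat_def mult_mat_vec_fun_eq B_entry_def by simp

lemma W_mat_mult:
  assumes n: "1 \<le> n" and i: "i \<le> n"
  shows "vec_index (W_mat n *\<^sub>v Matrix.vec (n + 1) g) i = quad n pi (node n i) g"
proof -
  define b where "b j = (\<Sum>l\<le>n. B_entry j l * coef n g l)" for j
  have b0: "b 0 = 0" by (simp add: b_def B_entry_def)
  have carr: "C_mat n \<in> carrier_mat (n + 1) (n + 1)" "PL_mat n \<in> carrier_mat (n + 1) (n + 1)"
    "B_mat n \<in> carrier_mat (n + 1) (n + 1)" "mat_inv (C_mat n) \<in> carrier_mat (n + 1) (n + 1)"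
    by (auto simp: C_mat_carrier[simplified] mat_inv_C_mat_carrier[simplified] PL_mat_def B_mat_def)
  \<comment> \<open>Row 0 of \<open>PL_mat\<close> chooses the constant term so that the
    antiderivative vanishes at cos pi = -1: for j >= 1 the entry (-1)^(j + 1) is - cos (j pi), and
    column 0 meets \<open>b 0 = 0\<close>.\<close>
  have PL: "PL_mat n *\<^sub>v Matrix.vec (n + 1) b = Matrix.vec (n + 1) (\<lambda>j. if j = 0 then - (\<Sum>j\<le>n. b j * cos (real j * pi)) else b j)"
    unfolding PL_mat_def mult_mat_vec_fun_eq
  proof -
    have "(\<Sum>j\<le>n. (if j = 0 then 1 else (- 1) ^ (j + 1)) * b j) = - (\<Sum>j\<le>n. b j * cos (real j * pi))"
      unfolding sum_negf[symmetric] by (intro sum.cong refl) (auto simp: b0 mult.commute)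
    then show "Matrix.vec (n + 1) (\<lambda>i. \<Sum>j\<le>n. (case (i, j) of (i, j) \<Rightarrow>
        if i = 0 then if j = 0 then 1 else (- 1) ^ (j + 1) else if i = j then 1 else 0) * b j)
      = Matrix.vec (n + 1) (\<lambda>j. if j = 0 then - (\<Sum>j\<le>n. b j * cos (real j * pi)) else b j)"
      by (intro eq_vecI) (simp_all add: if_distrib[of "\<lambda>x. x * _"] cong: if_cong)
  qed
  have "W_mat n *\<^sub>v Matrix.vec (n + 1) g = C_mat n *\<^sub>v (PL_mat n *\<^sub>v (B_mat n *\<^sub>v (mat_inv (C_mat n) *\<^sub>v Matrix.vec (n + 1) g)))"
    unfolding W_mat_def using carr
    by (simp add: assoc_mult_mat_vec[of _ "n + 1" "n + 1" _ "n + 1"] mult_carrier_mat[of _ "n + 1" "n + 1"])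
  also have "\<dots> = C_mat n *\<^sub>v Matrix.vec (n + 1) (\<lambda>j. if j = 0 then - (\<Sum>j\<le>n. b j * cos (real j * pi)) else b j)"
    unfolding mat_inv_C_mat_mult B_mat_mult b_def[symmetric] PL ..
  finally have "vec_index (W_mat n *\<^sub>v Matrix.vec (n + 1) g) i
      = (\<Sum>j\<le>n. cheb j (tau n i) * (if j = 0 then - (\<Sum>j\<le>n. b j * cos (real j * pi)) else b j))"
    unfolding C_mat_def by (simp only: mult_mat_vec_fun[OF i] prod.case)
  also have "\<dots> = (\<Sum>j\<le>n. (if j = 0 then - (\<Sum>j\<le>n. b j * cos (real j * pi)) else 0) + b j * cos (real j * node n i))"
    using i by (intro sum.cong refl) (auto simp: cheb_tau b0)
  also have "\<dots> = (\<Sum>j\<le>n. b j * cos (real j * node n i)) - (\<Sum>j\<le>n. b j * cos (real j * pi))"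
    unfolding sum.distrib by simp
  also have "\<dots> = quad n pi (node n i) g"
    unfolding b_def by (rule quad_B_entry[OF n, symmetric])
  finally show ?thesis .
qed

lemma V_mat_mult:
  assumes n: "1 \<le> n" and i: "i \<le> n"
  shows "vec_index (V_mat n *\<^sub>v Matrix.vec (n + 1) g) i = - quad n 0 (node n i) g"
proof -
  define b where "b j = (\<Sum>l\<le>n. B_entry j l * coef n g l)" for j
  have b0: "b 0 = 0" by (simp add: b_def B_entry_def)
  have carr: "C_mat n \<in> carrier_mat (n + 1) (n + 1)" "PR_mat n \<in> carrier_mat (n + 1) (n + 1)"
    "B_mat n \<in> carrier_mat (n + 1) (n + 1)" "mat_inv (C_mat n) \<in> carrier_mat (n + 1) (n + 1)"
    by (auto simp: C_mat_carrier[simplified] mat_inv_C_mat_carrier[simplified] PR_mat_def B_mat_def)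
  \<comment> \<open>Likewise the constant term makes the antiderivative, now with reversed sign,
    vanish at cos 0 = 1.\<close>
  have PR: "PR_mat n *\<^sub>v Matrix.vec (n + 1) b = Matrix.vec (n + 1) (\<lambda>j. if j = 0 then (\<Sum>j\<le>n. b j * cos (real j * 0)) else - b j)"
    unfolding PR_mat_def mult_mat_vec_fun_eq
    by (rule eq_vecI) (auto simp add: if_distrib[of "\<lambda>x. x * _"] cong: if_cong)
  have "V_mat n *\<^sub>v Matrix.vec (n + 1) g = C_mat n *\<^sub>v (PR_mat n *\<^sub>v (B_mat n *\<^sub>v (mat_inv (C_mat n) *\<^sub>v Matrix.vec (n + 1) g)))"
    unfolding V_mat_def using carr
    by (simp add: assoc_mult_mat_vec[of _ "n + 1" "n + 1" _ "n + 1"] mult_carrier_mat[of _ "n + 1" "n + 1"])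
  also have "\<dots> = C_mat n *\<^sub>v Matrix.vec (n + 1) (\<lambda>j. if j = 0 then (\<Sum>j\<le>n. b j * cos (real j * 0)) else - b j)"
    unfolding mat_inv_C_mat_mult B_mat_mult b_def[symmetric] PR ..
  finally have "vec_index (V_mat n *\<^sub>v Matrix.vec (n + 1) g) i
      = (\<Sum>j\<le>n. cheb j (tau n i) * (if j = 0 then (\<Sum>j\<le>n. b j * cos (real j * 0)) else - b j))"
    unfolding C_mat_def by (simp only: mult_mat_vec_fun[OF i] prod.case)
  also have "\<dots> = (\<Sum>j\<le>n. (if j = 0 then (\<Sum>j\<le>n. b j * cos (real j * 0)) else 0) - b j * cos (real j * node n i))"
    using i by (intro sum.cong refl) (auto simp: cheb_tau b0)
  also have "\<dots> = - ((\<Sum>j\<le>n. b j * cos (real j * node n i)) - (\<Sum>j\<le>n. b j * cos (real j * 0)))"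
    unfolding sum_subtractf by simp
  also have "\<dots> = - quad n 0 (node n i) g"
    unfolding b_def by (subst quad_B_entry[OF n]) simp
  finally show ?thesis .
qed

text \<open>For a < b this parametrises [a, b] by the angles in [0, pi], in decreasing direction: 0
  goes to b and pi to a.\<close>

definition eta_at :: "real \<Rightarrow> real \<Rightarrow> real \<Rightarrow> real" where
  "eta_at a b t = (b - a) / 2 * cos t + (a + b) / 2"

lemma eta_node: "eta a b n k = eta_at a b (node n k)"
  by (simp add: eta_def tau_def node_def eta_at_def)

text \<open>Row i of the Schur product freezes the first kernel argument at the i-th node, so the
  integration matrix acts on kernel times data in the second argument.\<close>

lemma schur_K_mat_mult:
  assumes A: "A \<in> carrier_mat (n + 1) (n + 1)" and i: "i \<le> n"
  shows "vec_index (schur_prod A (K_mat a b k n) *\<^sub>v Matrix.vec (n + 1) v) i =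
     vec_index (A *\<^sub>v Matrix.vec (n + 1) (\<lambda>j. k (eta a b n i) (eta a b n j) * v j)) i"
  using assms by (simp add: schur_prod_def K_mat_def scalar_prod_def mult.assoc)

lemma M_mat_carrier: "M_mat a b k1 k2 n \<in> carrier_mat (n + 1) (n + 1)"
  unfolding M_mat_def using W_mat_carrier[of n] V_mat_carrier[of n]
  by (auto simp: schur_prod_def)

lemma smult_mat_mult_vec:
  "dim_vec w = dim_col A \<Longrightarrow> (c \<cdot>\<^sub>m A) *\<^sub>v w = c \<cdot>\<^sub>v (A *\<^sub>v w)" for c :: "'a :: comm_semiring_0"
  by (rule eq_vecI) (auto simp: scalar_prod_def sum_distrib_left mult.assoc)

lemma M_mat_mult:
  assumes n: "1 \<le> n" and i: "i \<le> n"
  shows "vec_index (M_mat a b k1 k2 n *\<^sub>v Matrix.vec (n + 1) v) i =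
    v i + disc_op ((b - a) / 2) (\<lambda>t u. k1 (eta_at a b t) (eta_at a b u)) (\<lambda>t u. k2 (eta_at a b t) (eta_at a b u)) n v (node n i)"
proof -
  let ?v = "Matrix.vec (n + 1) v"
  note W = W_mat_carrier[of n] and V = V_mat_carrier[of n]
  let ?S1 = "schur_prod (W_mat n) (K_mat a b k1 n)" and ?S2 = "schur_prod (V_mat n) (K_mat a b k2 n)"
  have S: "?S1 \<in> carrier_mat (n + 1) (n + 1)" "?S2 \<in> carrier_mat (n + 1) (n + 1)"
    using W V by (auto simp: schur_prod_def)
  have "M_mat a b k1 k2 n *\<^sub>v ?v = ?v + ((b - a) / 2) \<cdot>\<^sub>v (?S1 *\<^sub>v ?v + ?S2 *\<^sub>v ?v)"
    unfolding M_mat_def using S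
    by (simp add: add_mult_distrib_mat_vec[of _ "n + 1" "n + 1"] smult_mat_mult_vec)
  then have "vec_index (M_mat a b k1 k2 n *\<^sub>v ?v) i = v i + (b - a) / 2 * (vec_index (?S1 *\<^sub>v ?v) i + vec_index (?S2 *\<^sub>v ?v) i)"
    using i S by simp
  then show ?thesis
    unfolding schur_K_mat_mult[OF W i] schur_K_mat_mult[OF V i] W_mat_mult[OF n i] V_mat_mult[OF n i]
    by (simp add: disc_op_def eta_node)
qed

section \<open>From componentwise stability to bounds of inverse matrices\<close>

lemma max_norm_le:
  assumes "v \<in> carrier_vec (n + 1)" "\<And>i. i \<le> n \<Longrightarrow> \<bar>vec_index v i\<bar> \<le> B"
  shows "max_norm v \<le> B"
  using assms by (auto simp: max_norm_def intro!: Max.boundedI)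

lemma max_norm_ge:
  assumes "v \<in> carrier_vec (n + 1)" "i \<le> n"
  shows "\<bar>vec_index v i\<bar> \<le> max_norm v"
  using assms by (auto simp: max_norm_def intro!: Max_ge)

lemma vec_vec_index: "v \<in> carrier_vec n \<Longrightarrow> Matrix.vec n (vec_index v) = v"
  by (rule eq_vecI) auto

text \<open>One estimate does both: \<delta> = 0 makes the kernel of \<open>A\<close> trivial and
  its determinant nonzero, and \<delta> = 1, applied to the image of a vector of norm at most 1
  under the inverse, bounds the inverse.\<close>

lemma inverse_bounded:
  assumes A: "A \<in> carrier_mat (n + 1) (n + 1)"
    and stable: "\<And>v \<delta>. (\<And>i. i \<le> n \<Longrightarrow> \<bar>vec_index (A *\<^sub>v Matrix.vec (n + 1) v) i\<bar> \<le> \<delta>) \<Longrightarrow> \<forall>i\<le>n. \<bar>v i\<bar> \<le> c * \<delta>"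
    and c: "0 \<le> c"
  shows "invertible_mat A \<and> op_norm (mat_inv A) \<le> c"
proof -
  have "Determinant.det A \<noteq> 0"
  proof
    assume "Determinant.det A = 0"
    then obtain v where v: "v \<in> carrier_vec (n + 1)" "v \<noteq> 0\<^sub>v (n + 1)" "A *\<^sub>v v = 0\<^sub>v (n + 1)"
      using det_0_iff_vec_prod_zero_field[OF A] by blast
    have "\<forall>i\<le>n. \<bar>vec_index v i\<bar> \<le> c * 0"
      by (rule stable) (unfold vec_vec_index[OF v(1)] v(3), simp)
    then have "v = 0\<^sub>v (n + 1)" using v(1) by (intro eq_vecI) auto
    with v show False by blast
  qed
  then have "A \<in> Units (ring_mat TYPE(real) (n + 1) ())"
    by (rule det_non_zero_imp_unit[OF A])
  then obtain B where B: "B \<in> carrier_mat (n + 1) (n + 1)" "B * A = 1\<^sub>m (n + 1)" "A * B = 1\<^sub>m (n + 1)"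
    unfolding Units_def by (auto simp: ring_mat_def)
  have "op_norm B \<le> c"
    unfolding op_norm_def
  proof (rule cSUP_least)
    have "max_norm (0\<^sub>v (n + 1)) \<le> 1" by (rule max_norm_le[where n = n]) auto
    then have "0\<^sub>v (n + 1) \<in> {v \<in> carrier_vec (dim_col B). max_norm v \<le> 1}" using B by simp
    then show "{v \<in> carrier_vec (dim_col B). max_norm v \<le> 1} \<noteq> {}" by blast
    fix v :: "real Matrix.vec" assume "v \<in> {v \<in> carrier_vec (dim_col B). max_norm v \<le> 1}"
    then have v: "v \<in> carrier_vec (n + 1)" "max_norm v \<le> 1" using B by auto
    have Bv: "B *\<^sub>v v \<in> carrier_vec (n + 1)" using B v by auto
    have "A *\<^sub>v (B *\<^sub>v v) = v"
      using assoc_mult_mat_vec[OF A B(1) v(1)] B v by simp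
    then have "\<forall>i\<le>n. \<bar>vec_index (B *\<^sub>v v) i\<bar> \<le> c * 1"
      using max_norm_ge[OF v(1)] v(2) by (intro stable) (unfold vec_vec_index[OF Bv], fastforce)
    then show "max_norm (B *\<^sub>v v) \<le> c" by (intro max_norm_le[OF Bv]) auto
  qed
  moreover have "mat_inv A = B" by (rule mat_inv_eq[OF A B(1,2)])
  moreover have "invertible_mat A"
    unfolding invertible_mat_def inverts_mat_def using A B by auto
  ultimately show ?thesis by simp
qed

section \<open>Consistency and convergence\<close>

lemma eta_at_mem:
  assumes "a < b"
  shows "eta_at a b t \<in> {a..b}"
proof -
  have "(b - a) / 2 * cos t \<le> (b - a) / 2 * 1" "(b - a) / 2 * (- 1) \<le> (b - a) / 2 * cos t"
    using assms by (intro mult_left_mono; simp)+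
  then show ?thesis by (simp add: eta_at_def field_simps)
qed

lemma eta_at_0: "eta_at a b 0 = b" and eta_at_pi: "eta_at a b pi = a"
  by (simp_all add: eta_at_def field_simps)

lemma eta_at_has_derivative:
  "(eta_at a b has_real_derivative - ((b - a) / 2 * sin t)) (at t within S)"
  unfolding eta_at_def[abs_def] by (auto intro!: derivative_eq_intros)

lemma continuous_on_eta_at: "continuous_on S (eta_at a b)"
  unfolding eta_at_def[abs_def] by (intro continuous_intros)

lemma eta_at_surj:
  assumes "a < b" "s \<in> {a..b}"
  obtains t where "t \<in> {0..pi}" "eta_at a b t = s"
  using IVT2'[of "eta_at a b" pi s 0] assms continuous_on_eta_at
  by (auto simp: eta_at_0 eta_at_pi)

text \<open>The substitution s = \<open>eta_at a b u\<close> has ds = - (b - a) / 2 sin u du and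
  reverses the orientation: the endpoint pi becomes the lower limit a, the endpoint 0 the upper
  limit b.\<close>

lemma signed_int_eta_at:
  assumes "a < b" and f: "continuous_on {a..b} f" and t: "t \<in> {0..pi}"
  shows "(b - a) / 2 * signed_int pi t (\<lambda>u. f (eta_at a b u)) = integral {a..eta_at a b t} f"
    and "(b - a) / 2 * signed_int 0 t (\<lambda>u. f (eta_at a b u)) = - integral {eta_at a b t..b} f"
proof -
  have *: "(b - a) / 2 * integral {x..y} (\<lambda>u. f (eta_at a b u) * sin u)
      = integral {eta_at a b y..eta_at a b x} f - integral {eta_at a b x..eta_at a b y} f" if "x \<le> y" for x y
  proof -
    have "((\<lambda>u. - ((b - a) / 2 * sin u) *\<^sub>R f (eta_at a b u)) has_integral
        (integral {eta_at a b x..eta_at a b y} f - integral {eta_at a b y..eta_at a b x} f)) {x..y}"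
      by (rule has_integral_substitution_general[where s = "{}" and c = a and d = b])
        (use that f eta_at_mem[OF assms(1)] in \<open>auto simp del: times_divide_eq_left intro: continuous_on_eta_at eta_at_has_derivative\<close>)
    then have "((\<lambda>u. - ((b - a) / 2 * (f (eta_at a b u) * sin u))) has_integral
        (integral {eta_at a b x..eta_at a b y} f - integral {eta_at a b y..eta_at a b x} f)) {x..y}"
      by (simp add: mult_ac)
    then have "integral {x..y} (\<lambda>u. - ((b - a) / 2 * (f (eta_at a b u) * sin u)))
        = integral {eta_at a b x..eta_at a b y} f - integral {eta_at a b y..eta_at a b x} f"
      by (rule integral_unique)
    then show ?thesis by simp
  qed
  \<comment> \<open>The general substitution rule yields a difference of two set integrals, one for
    each orientation; the reversed one is 0.\<close>
  have "integral {x..y} f = 0" if "y \<le> x" for x y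
    using that by (cases "x = y") auto
  then have triv: "integral {eta_at a b t..a} f = 0" "integral {b..eta_at a b t} f = 0"
    using eta_at_mem[OF assms(1), of t] by auto
  show "(b - a) / 2 * signed_int pi t (\<lambda>u. f (eta_at a b u)) = integral {a..eta_at a b t} f"
    using *[of t pi] t triv by (simp add: signed_int_def eta_at_pi)
  have "signed_int 0 t (\<lambda>u. f (eta_at a b u)) = - integral {0..t} (\<lambda>u. f (eta_at a b u) * sin u)"
    using t by (auto simp: signed_int_def)
  then show "(b - a) / 2 * signed_int 0 t (\<lambda>u. f (eta_at a b u)) = - integral {eta_at a b t..b} f"
    using *[of 0 t] t triv by (simp add: eta_at_0)
qed

lemma cont_op_eta_at:
  assumes "a < b" and t: "t \<in> {0..pi}" and x: "continuous_on {a..b} x"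
    and k: "continuous_on ({a..b} \<times> {a..b}) (\<lambda>(t, s). k1 t s)" "continuous_on ({a..b} \<times> {a..b}) (\<lambda>(t, s). k2 t s)"
    and X: "\<And>u. u \<in> {0..pi} \<Longrightarrow> X u = x (eta_at a b u)"
  shows "X t + cont_op ((b - a) / 2) (\<lambda>t u. k1 (eta_at a b t) (eta_at a b u)) (\<lambda>t u. k2 (eta_at a b t) (eta_at a b u)) X t
    = integral_op a b k1 k2 x (eta_at a b t)"
proof -
  have c: "continuous_on {a..b} (\<lambda>s. k1 (eta_at a b t) s * x s)" "continuous_on {a..b} (\<lambda>s. k2 (eta_at a b t) s * x s)"
    using continuous_on_square_slice[OF k(1) eta_at_mem[OF assms(1)]] continuous_on_square_slice[OF k(2) eta_at_mem[OF assms(1)]]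
    by (auto intro: continuous_on_mult x)
  have s: "signed_int \<alpha> t (\<lambda>u. \<kappa> u * X u) = signed_int \<alpha> t (\<lambda>u. \<kappa> u * x (eta_at a b u))" if "\<alpha> \<in> {0..pi}" for \<alpha> \<kappa>
    using t that X by (auto simp: signed_int_def intro!: Henstock_Kurzweil_Integration.integral_cong)
  show ?thesis
    unfolding cont_op_def s[of pi, simplified] s[of 0, simplified] right_diff_distrib
      signed_int_eta_at(1)[OF assms(1) c(1) t] signed_int_eta_at(2)[OF assms(1) c(2) t]
    using X[OF t] by (simp add: integral_op_def)
qed

lemma continuous_on_kernel_eta_at:
  assumes "a < b" and k: "continuous_on ({a..b} \<times> {a..b}) (\<lambda>(t, s). k t s)"
  shows "continuous_on (S \<times> T) (\<lambda>(t, u). k (eta_at a b t) (eta_at a b u))"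
proof -
  have "continuous_on (S \<times> T) (\<lambda>x. (\<lambda>(t, s). k t s) (eta_at a b (fst x), eta_at a b (snd x)))"
    by (rule continuous_on_compose2[OF k])
      (use eta_at_mem[OF assms(1)] in \<open>auto intro!: continuous_intros continuous_on_compose2[OF continuous_on_eta_at[of UNIV]]\<close>)
  then show ?thesis by (simp add: case_prod_unfold)
qed

text \<open>The constant is uniform in t because the m-th s-derivative is bounded on the whole
  square. Rescaling [a, b] to [-1, 1] multiplies the i-th derivative by
  \<open>h ^ i\<close>.\<close>

lemma kernel_quad_error:
  fixes f :: "real \<Rightarrow> real \<Rightarrow> real"
  assumes "a < b" and m: "2 \<le> m" and f: "Cn_on m ({a..b} \<times> {a..b}) (\<lambda>(t, s). f t s)"
  obtains C where "\<And>n t u \<alpha>. 2 * m \<le> n \<Longrightarrow> t \<in> {a..b} \<Longrightarrow> u \<in> {0..pi} \<Longrightarrow> \<alpha> \<in> {0..pi} \<Longrightarrow>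
    \<bar>quad n \<alpha> u (\<lambda>k. f t (eta_at a b (node n k))) - signed_int \<alpha> u (\<lambda>u. f t (eta_at a b u))\<bar> \<le> C / real n ^ (m - 1)"
proof -
  obtain D where D: "D 0 = f" "continuous_on ({a..b} \<times> {a..b}) (\<lambda>(t, s). D m t s)"
    "\<And>i t s. i < m \<Longrightarrow> t \<in> {a..b} \<Longrightarrow> s \<in> {a..b} \<Longrightarrow> (D i t has_real_derivative D (Suc i) t s) (at s within {a..b})"
    by (rule Cn_on_partial_snd_iterate[OF f]) blast
  obtain B where B: "0 < B" "\<And>t s. t \<in> {a..b} \<Longrightarrow> s \<in> {a..b} \<Longrightarrow> \<bar>D m t s\<bar> \<le> B"
    by (rule square_bound[OF D(2)]) blast
  define h where "h = (b - a) / 2"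
  have h: "0 < h" using assms(1) by (simp add: h_def)
  define l where "l s = h * s + (a + b) / 2" for s
  have l_mem: "l s \<in> {a..b}" if "s \<in> {-1..1}" for s
    using eta_at_mem[OF assms(1), of "arccos s"] that by (simp add: l_def h_def eta_at_def)
  have l_img: "l ` {-1..1} \<subseteq> {a..b}" using l_mem by auto
  have l_deriv: "(l has_real_derivative h) (at s within S)" for s S
    unfolding l_def[abs_def] by (auto intro!: derivative_eq_intros)
  define E where "E i t s = h ^ i * D i t (l s)" for i t s
  have E_deriv: "(E i t has_real_derivative E (Suc i) t s) (at s within {-1..1})"
    if "i < m" "t \<in> {a..b}" "s \<in> {-1..1}" for i t s
  proof -
    have "(D i t has_real_derivative D (Suc i) t (l s)) (at (l s) within l ` {-1..1})"
      by (rule has_field_derivative_subset[OF D(3) l_img]) (use that l_mem in auto)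
    from DERIV_cmult[OF DERIV_image_chain[OF this l_deriv], of "h ^ i"]
    show ?thesis unfolding E_def[abs_def] o_def by (simp add: mult_ac)
  qed
  have E_cont: "continuous_on {-1..1} (E m t)" if "t \<in> {a..b}" for t
    unfolding E_def using l_img
    by (intro continuous_intros continuous_on_compose2[OF continuous_on_square_slice[OF D(2) that], of _ l])
      (auto simp: l_def[abs_def] intro!: continuous_intros)
  have E_bound: "\<bar>E m t s\<bar> \<le> h ^ m * B" if "t \<in> {a..b}" "s \<in> {-1..1}" for t s
    unfolding E_def abs_mult using h that B(2)[OF that(1) l_mem[OF that(2)]] by simp
  show ?thesis
  proof (rule that[of "13 * (4 * 2 ^ m * (h ^ m * B))"])
    fix n t u \<alpha> assume n: "2 * m \<le> n" and t: "t \<in> {a..b}" and u: "u \<in> {0..pi}" and \<alpha>: "\<alpha> \<in> {0..pi}"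
    obtain c where c: "\<And>u. u \<in> {0..pi} \<Longrightarrow>
        \<bar>E 0 t (cos u) - (\<Sum>l<n. c l * cos (real l * u))\<bar> \<le> 4 * 2 ^ m * (h ^ m * B) / real n ^ (m - 1)"
      using cheb_approx[of m "\<lambda>i. E i t" "h ^ m * B" n] E_deriv E_cont E_bound t m n by blast
    have E0: "E 0 t (cos u) = f t (eta_at a b u)" for u
      by (simp add: E_def D(1) l_def h_def eta_at_def)
    have fc: "continuous_on {0..pi} (\<lambda>u. f t (eta_at a b u))"
      by (rule continuous_on_compose2[OF continuous_on_square_slice[OF Cn_on_continuous[OF f] t] continuous_on_eta_at])
        (use eta_at_mem[OF assms(1)] in auto)
    have "\<bar>quad n \<alpha> u (\<lambda>k. f t (eta_at a b (node n k))) - signed_int \<alpha> u (\<lambda>u. f t (eta_at a b u))\<bar>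
        \<le> 13 * (4 * 2 ^ m * (h ^ m * B) / real n ^ (m - 1))"
      \<comment> \<open>The approximant has n terms, hence degree n - 1, just what
        \<open>quad_exact\<close> permits.\<close>
      by (rule quad_error[OF fc u \<alpha> order_refl, where a = c]) (use c E0 in auto)
    then show "\<bar>quad n \<alpha> u (\<lambda>k. f t (eta_at a b (node n k))) - signed_int \<alpha> u (\<lambda>u. f t (eta_at a b u))\<bar>
        \<le> 13 * (4 * 2 ^ m * (h ^ m * B)) / real n ^ (m - 1)"
      by simp
  qed
qed

lemma disc_op_consistent:
  assumes "a < b" and m: "2 \<le> m"
    and k1: "Cn_on m ({a..b} \<times> {a..b}) (\<lambda>(t, s). k1 t s)" and k2: "Cn_on m ({a..b} \<times> {a..b}) (\<lambda>(t, s). k2 t s)"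
    and x: "Cn_on m {a..b} x"
  obtains C where "\<And>n t. 2 * m \<le> n \<Longrightarrow> t \<in> {0..pi} \<Longrightarrow>
    \<bar>x (eta_at a b t) + disc_op ((b - a) / 2) (\<lambda>t u. k1 (eta_at a b t) (eta_at a b u)) (\<lambda>t u. k2 (eta_at a b t) (eta_at a b u)) n (\<lambda>k. x (eta_at a b (node n k))) t
      - integral_op a b k1 k2 x (eta_at a b t)\<bar> \<le> C / real n ^ (m - 1)"
proof -
  have f: "Cn_on m ({a..b} \<times> {a..b}) (\<lambda>(t, s). k t s * x s)"
    if "Cn_on m ({a..b} \<times> {a..b}) (\<lambda>(t, s). k t s)" for k
    using Cn_on_mult[OF that Cn_on_snd[OF x]] by (simp add: case_prod_unfold)
  obtain C1 where C1: "\<And>n t u \<alpha>. 2 * m \<le> n \<Longrightarrow> t \<in> {a..b} \<Longrightarrow> u \<in> {0..pi} \<Longrightarrow> \<alpha> \<in> {0..pi} \<Longrightarrow>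
    \<bar>quad n \<alpha> u (\<lambda>k. k1 t (eta_at a b (node n k)) * x (eta_at a b (node n k))) - signed_int \<alpha> u (\<lambda>u. k1 t (eta_at a b u) * x (eta_at a b u))\<bar> \<le> C1 / real n ^ (m - 1)"
    by (rule kernel_quad_error[OF assms(1) m f[OF k1]]) blast
  obtain C2 where C2: "\<And>n t u \<alpha>. 2 * m \<le> n \<Longrightarrow> t \<in> {a..b} \<Longrightarrow> u \<in> {0..pi} \<Longrightarrow> \<alpha> \<in> {0..pi} \<Longrightarrow>
    \<bar>quad n \<alpha> u (\<lambda>k. k2 t (eta_at a b (node n k)) * x (eta_at a b (node n k))) - signed_int \<alpha> u (\<lambda>u. k2 t (eta_at a b u) * x (eta_at a b u))\<bar> \<le> C2 / real n ^ (m - 1)"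
    by (rule kernel_quad_error[OF assms(1) m f[OF k2]]) blast
  show ?thesis
  proof (rule that[of "(b - a) / 2 * (C1 + C2)"])
    fix n t assume n: "2 * m \<le> n" and t: "t \<in> {0..pi}"
    let ?\<kappa>1 = "\<lambda>t u. k1 (eta_at a b t) (eta_at a b u)" and ?\<kappa>2 = "\<lambda>t u. k2 (eta_at a b t) (eta_at a b u)"
    let ?X = "\<lambda>u. x (eta_at a b u)"
    have eq: "?X t + cont_op ((b - a) / 2) ?\<kappa>1 ?\<kappa>2 ?X t = integral_op a b k1 k2 x (eta_at a b t)"
      by (rule cont_op_eta_at[OF assms(1) t Cn_on_continuous[OF x] Cn_on_continuous[OF k1] Cn_on_continuous[OF k2]]) simp
    let ?q1 = "quad n pi t (\<lambda>k. ?\<kappa>1 t (node n k) * ?X (node n k)) - signed_int pi t (\<lambda>u. ?\<kappa>1 t u * ?X u)"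
    let ?q2 = "quad n 0 t (\<lambda>k. ?\<kappa>2 t (node n k) * ?X (node n k)) - signed_int 0 t (\<lambda>u. ?\<kappa>2 t u * ?X u)"
    have "\<bar>?q1 - ?q2\<bar> \<le> \<bar>?q1\<bar> + \<bar>?q2\<bar>" by (rule abs_triangle_ineq4)
    also have "\<dots> \<le> C1 / real n ^ (m - 1) + C2 / real n ^ (m - 1)"
      using eta_at_mem[OF assms(1)] t n by (intro add_mono C1 C2) auto
    finally have le: "(b - a) / 2 * \<bar>?q1 - ?q2\<bar> \<le> (b - a) / 2 * (C1 / real n ^ (m - 1) + C2 / real n ^ (m - 1))"
      using assms(1) by (intro mult_left_mono) auto
    have E: "?X t + disc_op ((b - a) / 2) ?\<kappa>1 ?\<kappa>2 n (\<lambda>k. ?X (node n k)) t - integral_op a b k1 k2 x (eta_at a b t)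
        = (b - a) / 2 * (?q1 - ?q2)"
      unfolding eq[symmetric] disc_op_def cont_op_def by (simp only: right_diff_distrib)
    have abs: "\<bar>(b - a) / 2 * (?q1 - ?q2)\<bar> = (b - a) / 2 * \<bar>?q1 - ?q2\<bar>"
      unfolding abs_mult using assms(1) by simp
    have C: "(b - a) / 2 * (C1 / real n ^ (m - 1) + C2 / real n ^ (m - 1)) = (b - a) / 2 * (C1 + C2) / real n ^ (m - 1)"
      by (simp add: add_divide_distrib distrib_left)
    show "\<bar>?X t + disc_op ((b - a) / 2) ?\<kappa>1 ?\<kappa>2 n (\<lambda>k. ?X (node n k)) t - integral_op a b k1 k2 x (eta_at a b t)\<bar>
        \<le> (b - a) / 2 * (C1 + C2) / real n ^ (m - 1)"
      unfolding E abs using le unfolding C .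
  qed
qed

text \<open>Bijectivity is given on \<open>C_space\<close> only. A continuous null function is
  smooth enough to lie there by \<open>integral_op_null_smooth\<close>, and has the same image as
  zero; \<open>restrict\<close> enters because the space consists of extensional functions.\<close>

lemma integral_op_injective:
  fixes k1 k2 :: "real \<Rightarrow> real \<Rightarrow> real"
  assumes inv: "invertible_on_C r a b (integral_op a b k1 k2)"
    and k1: "C_on r ({a..b} \<times> {a..b}) (\<lambda>(t, s). k1 t s)" and k2: "C_on r ({a..b} \<times> {a..b}) (\<lambda>(t, s). k2 t s)"
    and x: "continuous_on {a..b} x" and null: "\<And>t. t \<in> {a..b} \<Longrightarrow> integral_op a b k1 k2 x t = 0"
    and "s \<in> {a..b}"
  shows "x s = 0"
proof -
  have smooth: "Cn_on m {a..b} x" if "enat m \<le> r" for m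
    by (rule integral_op_null_smooth[OF _ _ x null]) (use k1 k2 that in \<open>auto simp: C_on_def\<close>)
  have "Cn_on m {a..b} (restrict x {a..b})" if "enat m \<le> r" for m
    by (rule Cn_on_cong[OF smooth[OF that]]) simp
  then have X: "restrict x {a..b} \<in> C_space r a b"
    by (simp add: C_space_def C_on_def)
  have "Cn_on m {a..b} (restrict (\<lambda>_. 0) {a..b})" for m
    by (rule Cn_on_cong[OF Cn_on_const[of _ _ 0]]) simp
  then have Z: "restrict (\<lambda>_. 0) {a..b} \<in> C_space r a b"
    by (simp add: C_space_def C_on_def)
  have restr: "integral_op a b k1 k2 (restrict f {a..b}) t = integral_op a b k1 k2 f t" if t: "t \<in> {a..b}" for f t
  proof -
    have "integral {a..t} (\<lambda>s. k1 t s * restrict f {a..b} s) = integral {a..t} (\<lambda>s. k1 t s * f s)"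
      "integral {t..b} (\<lambda>s. k2 t s * restrict f {a..b} s) = integral {t..b} (\<lambda>s. k2 t s * f s)"
      using t by (intro Henstock_Kurzweil_Integration.integral_cong; simp)+
    then show ?thesis using t by (simp only: integral_op_def restrict_apply')
  qed
  have "integral_op a b k1 k2 (restrict x {a..b}) t = integral_op a b k1 k2 x t" if "t \<in> {a..b}" for t
    by (rule restr[OF that])
  moreover have "integral_op a b k1 k2 (restrict (\<lambda>_. 0) {a..b}) t = 0" if "t \<in> {a..b}" for t
    unfolding restr[OF that] by (simp add: integral_op_def)
  ultimately have "restrict (integral_op a b k1 k2 (restrict x {a..b})) {a..b} = restrict (integral_op a b k1 k2 (restrict (\<lambda>_. 0) {a..b})) {a..b}"
    using null by (intro restrict_ext) simp
  then have "restrict x {a..b} = restrict (\<lambda>_. 0) {a..b}"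
    using inv X Z unfolding invertible_on_C_def bij_betw_def inj_on_def by blast
  then show ?thesis using \<open>s \<in> {a..b}\<close> by (metis restrict_apply')
qed

lemma M_mat_stable:
  fixes k1 k2 :: "real \<Rightarrow> real \<Rightarrow> real"
  assumes "a < b" and inv: "invertible_on_C r a b (integral_op a b k1 k2)"
    and k1: "C_on r ({a..b} \<times> {a..b}) (\<lambda>(t, s). k1 t s)" and k2: "C_on r ({a..b} \<times> {a..b}) (\<lambda>(t, s). k2 t s)"
  obtains N c where "0 < c" "\<And>n v \<delta>. N \<le> n \<Longrightarrow>
    (\<And>i. i \<le> n \<Longrightarrow> \<bar>vec_index (M_mat a b k1 k2 n *\<^sub>v Matrix.vec (n + 1) v) i\<bar> \<le> \<delta>) \<Longrightarrow> \<forall>i\<le>n. \<bar>v i\<bar> \<le> c * \<delta>"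
proof -
  let ?\<kappa>1 = "\<lambda>t u. k1 (eta_at a b t) (eta_at a b u)" and ?\<kappa>2 = "\<lambda>t u. k2 (eta_at a b t) (eta_at a b u)"
  have c1: "continuous_on ({a..b} \<times> {a..b}) (\<lambda>(t, s). k1 t s)" and c2: "continuous_on ({a..b} \<times> {a..b}) (\<lambda>(t, s). k2 t s)"
    using k1 k2 unfolding C_on_def by (metis Cn_on.simps(1) enat_0 zero_le)+
  have "\<exists>N c. 0 < c \<and> (\<forall>n\<ge>N. \<forall>v \<delta>. (\<forall>i\<le>n. \<bar>v i + disc_op ((b - a) / 2) ?\<kappa>1 ?\<kappa>2 n v (node n i)\<bar> \<le> \<delta>) \<longrightarrow> (\<forall>i\<le>n. \<bar>v i\<bar> \<le> c * \<delta>))"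
  proof (rule disc_op_stable)
    fix X t
    assume X: "continuous_on {0..pi} X" and null: "\<And>t. t \<in> {0..pi} \<Longrightarrow> X t + cont_op ((b - a) / 2) ?\<kappa>1 ?\<kappa>2 X t = 0"
      and t: "t \<in> {0..pi}"
    \<comment> \<open>The inverse of \<open>eta_at\<close> carries the angle function
      \<open>X\<close> back to [a, b].\<close>
    define x where "x s = X (arccos ((s - (a + b) / 2) / ((b - a) / 2)))" for s
    have arg: "(s - (a + b) / 2) / ((b - a) / 2) \<in> {-1..1}" if "s \<in> {a..b}" for s
      using that assms(1) by (auto simp: field_simps)
    have "continuous_on {a..b} x"
      unfolding x_def using arg assms(1)
      by (intro continuous_on_compose2[OF X] continuous_on_compose2[OF continuous_on_arccos'] continuous_intros)
        (auto simp: arccos_lbound arccos_ubound)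
    moreover have Xx: "X u = x (eta_at a b u)" if "u \<in> {0..pi}" for u
      using that assms(1) by (simp add: x_def eta_at_def arccos_cos)
    moreover have "integral_op a b k1 k2 x s = 0" if "s \<in> {a..b}" for s
    proof -
      obtain u where u: "u \<in> {0..pi}" "eta_at a b u = s" by (rule eta_at_surj[OF assms(1) \<open>s \<in> {a..b}\<close>])
      show ?thesis
        using cont_op_eta_at[OF assms(1) u(1) \<open>continuous_on {a..b} x\<close> c1 c2 Xx] null[OF u(1)] u(2) by simp
    qed
    ultimately show "X t = 0"
      using integral_op_injective[OF inv k1 k2, of x "eta_at a b t"] eta_at_mem[OF assms(1)] t by simp
  qed (intro continuous_on_kernel_eta_at[OF assms(1)] c1 c2)+
  then obtain N c where c: "0 < c" and N: "\<forall>n\<ge>N. \<forall>v \<delta>.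
      (\<forall>i\<le>n. \<bar>v i + disc_op ((b - a) / 2) ?\<kappa>1 ?\<kappa>2 n v (node n i)\<bar> \<le> \<delta>) \<longrightarrow> (\<forall>i\<le>n. \<bar>v i\<bar> \<le> c * \<delta>)"
    by (elim exE conjE) (rule that)
  show ?thesis
  \<comment> \<open>The row formula \<open>M_mat_mult\<close> is established for n >= 1.\<close>
  proof (rule that[OF c, of "max N 1"])
    fix n :: nat and v :: "nat \<Rightarrow> real" and \<delta> :: real
    assume n: "max N 1 \<le> n" and le: "\<And>i. i \<le> n \<Longrightarrow> \<bar>vec_index (M_mat a b k1 k2 n *\<^sub>v Matrix.vec (n + 1) v) i\<bar> \<le> \<delta>"
    have "\<forall>i\<le>n. \<bar>v i + disc_op ((b - a) / 2) ?\<kappa>1 ?\<kappa>2 n v (node n i)\<bar> \<le> \<delta>"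
      using le M_mat_mult[of n _ a b k1 k2 v] n by (metis max.boundedE)
    moreover have "N \<le> n" using n by simp
    ultimately show "\<forall>i\<le>n. \<bar>v i\<bar> \<le> c * \<delta>"
      using N[THEN spec, THEN mp, THEN spec, THEN spec, THEN mp] by blast
  qed
qed

text \<open>Since \<open>xbar\<close> solves the discrete system, the matrix maps the error to the
  consistency residual of the exact solution, and stability bounds the error by it. Any m >= 2 up to
  r is allowed, which serves finite and infinite r alike.\<close>

lemma M_mat_convergence:
  fixes k1 k2 :: "real \<Rightarrow> real \<Rightarrow> real"
  assumes "a < b" and m: "2 \<le> m" and inv: "invertible_on_C r a b (integral_op a b k1 k2)"
    and k1: "C_on r ({a..b} \<times> {a..b}) (\<lambda>(t, s). k1 t s)" and k2: "C_on r ({a..b} \<times> {a..b}) (\<lambda>(t, s). k2 t s)"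
    and x: "C_on r {a..b} x" and mr: "enat m \<le> r"
    and sol: "\<forall>t\<in>{a..b}. integral_op a b k1 k2 x t = y t"
    and xbar: "\<forall>\<^sub>F n in sequentially. xbar n \<in> carrier_vec (n + 1) \<and> M_mat a b k1 k2 n *\<^sub>v xbar n = sample a b y n"
  shows "(\<lambda>n. max_norm (sample a b x n - xbar n)) \<in> O(\<lambda>n. real n powr (1 - real m))"
proof -
  obtain N c where c: "0 < c" and N: "\<And>n v \<delta>. N \<le> n \<Longrightarrow>
    (\<And>i. i \<le> n \<Longrightarrow> \<bar>vec_index (M_mat a b k1 k2 n *\<^sub>v Matrix.vec (n + 1) v) i\<bar> \<le> \<delta>) \<Longrightarrow> \<forall>i\<le>n. \<bar>v i\<bar> \<le> c * \<delta>"
    by (rule M_mat_stable[OF assms(1) inv k1 k2]) blast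
  obtain C where C: "\<And>n t. 2 * m \<le> n \<Longrightarrow> t \<in> {0..pi} \<Longrightarrow>
    \<bar>x (eta_at a b t) + disc_op ((b - a) / 2) (\<lambda>t u. k1 (eta_at a b t) (eta_at a b u)) (\<lambda>t u. k2 (eta_at a b t) (eta_at a b u)) n (\<lambda>k. x (eta_at a b (node n k))) t
      - integral_op a b k1 k2 x (eta_at a b t)\<bar> \<le> C / real n ^ (m - 1)"
    by (rule disc_op_consistent[OF assms(1) m, of k1 k2 x]) (use k1 k2 x mr in \<open>auto simp: C_on_def\<close>)
  have "\<forall>\<^sub>F n in sequentially. norm (max_norm (sample a b x n - xbar n)) \<le> c * C * norm (real n powr (1 - real m))"
    using xbar eventually_ge_at_top[of "max N (2 * m)"]
  proof eventually_elim
    case (elim n)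
    then have n: "N \<le> n" "2 * m \<le> n" "1 \<le> n" using m by auto
    have xb: "xbar n \<in> carrier_vec (n + 1)" and sx: "sample a b x n \<in> carrier_vec (n + 1)"
      using elim by (auto simp: sample_def)
    let ?d = "sample a b x n - xbar n"
    have d: "?d \<in> carrier_vec (n + 1)" using xb sx by auto
    have "\<forall>i\<le>n. \<bar>vec_index ?d i\<bar> \<le> c * (C / real n ^ (m - 1))"
    proof (rule N[OF n(1)], unfold vec_vec_index[OF d])
      fix i assume i: "i \<le> n"
      have "M_mat a b k1 k2 n *\<^sub>v ?d = M_mat a b k1 k2 n *\<^sub>v sample a b x n - sample a b y n"
        using elim by (simp add: mult_minus_distrib_mat_vec[OF M_mat_carrier sx xb])
      then have "vec_index (M_mat a b k1 k2 n *\<^sub>v ?d) i = vec_index (M_mat a b k1 k2 n *\<^sub>v sample a b x n) i - y (eta a b n i)"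
        using i by (simp add: sample_def del: index_mult_mat_vec)
      also have "vec_index (M_mat a b k1 k2 n *\<^sub>v sample a b x n) i = x (eta_at a b (node n i)) +
          disc_op ((b - a) / 2) (\<lambda>t u. k1 (eta_at a b t) (eta_at a b u)) (\<lambda>t u. k2 (eta_at a b t) (eta_at a b u))
            n (\<lambda>k. x (eta_at a b (node n k))) (node n i)"
        unfolding sample_def eta_node by (rule M_mat_mult[OF n(3) i])
      also have "y (eta a b n i) = integral_op a b k1 k2 x (eta_at a b (node n i))"
        using sol eta_at_mem[OF assms(1)] by (simp add: eta_node)
      finally show "\<bar>vec_index (M_mat a b k1 k2 n *\<^sub>v ?d) i\<bar> \<le> C / real n ^ (m - 1)"
        using C[OF n(2), of "node n i"] node_bounds[OF i]
        by simp
    qed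
    then have "max_norm ?d \<le> c * (C / real n ^ (m - 1))" by (intro max_norm_le[OF d]) auto
    moreover have "0 \<le> max_norm ?d" using max_norm_ge[OF d, of 0] by linarith
    moreover have "real n powr (1 - real m) = 1 / real n ^ (m - 1)"
    proof -
      have "real n powr (1 - real m) = real n powr (- real (m - 1))" using m by (simp add: of_nat_diff)
      also have "\<dots> = 1 / real n ^ (m - 1)" using n by (simp only: powr_minus powr_realpow) (simp add: inverse_eq_divide)
      finally show ?thesis .
    qed
    ultimately show ?case by simp
  qed
  then show ?thesis by (rule bigoI)
qed

theorem mainTheorem2:
  fixes a b :: real and p1 p2 q r :: enat
    and k k1 k2 :: "real \<Rightarrow> real \<Rightarrow> real" and x y :: "real \<Rightarrow> real"
  assumes "a < b"
    and "r = min p1 (min p2 q)" and "r > 1"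
    and "semismooth p1 p2 a b k k1 k2"
    and "C_on q {a..b} y"
    and "invertible_on_C r a b (integral_op a b k1 k2)"
    and "C_on r {a..b} x"
    and "\<forall>t\<in>{a..b}. integral_op a b k1 k2 x t = y t"
  shows "(\<exists>c. \<forall>\<^sub>F n in sequentially.
            invertible_mat (M_mat a b k1 k2 n) \<and> op_norm (mat_inv (M_mat a b k1 k2 n)) \<le> c) \<and>
         (\<forall>xbar :: nat \<Rightarrow> real Matrix.vec.
            (\<forall>\<^sub>F n in sequentially. xbar n \<in> carrier_vec (n + 1) \<and>
               M_mat a b k1 k2 n *\<^sub>v xbar n = sample a b y n) \<longrightarrow>
            (\<forall>m. r = enat m \<longrightarrow>
               (\<lambda>n. max_norm (sample a b x n - xbar n)) \<in> O(\<lambda>n. real n powr (1 - real m))) \<and>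
            (p1 = \<infinity> \<and> p2 = \<infinity> \<and> q = \<infinity> \<longrightarrow>
               (\<forall>N. (\<lambda>n. max_norm (sample a b x n - xbar n)) \<in> O(\<lambda>n. real n powr (- real N)))))"
proof (intro conjI allI impI)
  have "r \<le> p1" "r \<le> p2" unfolding assms(2) by (simp_all add: min.coboundedI2)
  then have k1: "C_on r ({a..b} \<times> {a..b}) (\<lambda>(t, s). k1 t s)" and k2: "C_on r ({a..b} \<times> {a..b}) (\<lambda>(t, s). k2 t s)"
    using assms(4) unfolding semismooth_def C_on_def by (meson order_trans)+
  obtain N c where c: "0 < c" and N: "\<And>n v \<delta>. N \<le> n \<Longrightarrow>
    (\<And>i. i \<le> n \<Longrightarrow> \<bar>vec_index (M_mat a b k1 k2 n *\<^sub>v Matrix.vec (n + 1) v) i\<bar> \<le> \<delta>) \<Longrightarrow> \<forall>i\<le>n. \<bar>v i\<bar> \<le> c * \<delta>"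
    by (rule M_mat_stable[OF assms(1,6) k1 k2]) blast
  have "invertible_mat (M_mat a b k1 k2 n) \<and> op_norm (mat_inv (M_mat a b k1 k2 n)) \<le> c" if "N \<le> n" for n
    by (rule inverse_bounded[OF M_mat_carrier N[OF that]]) (use c in auto)
  then show "\<exists>c. \<forall>\<^sub>F n in sequentially. invertible_mat (M_mat a b k1 k2 n) \<and> op_norm (mat_inv (M_mat a b k1 k2 n)) \<le> c"
    by (intro exI[of _ c] eventually_sequentiallyI)
  fix xbar :: "nat \<Rightarrow> real Matrix.vec"
  assume xbar: "\<forall>\<^sub>F n in sequentially. xbar n \<in> carrier_vec (n + 1) \<and> M_mat a b k1 k2 n *\<^sub>v xbar n = sample a b y n"
  note conv = M_mat_convergence[OF assms(1) _ assms(6) k1 k2 assms(7) _ assms(8) xbar]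
  show "(\<lambda>n. max_norm (sample a b x n - xbar n)) \<in> O(\<lambda>n. real n powr (1 - real m))" if "r = enat m" for m
  proof (rule conv)
    show "2 \<le> m" using assms(3) that by (simp add: one_enat_def)
  qed (simp add: that)
  show "(\<lambda>n. max_norm (sample a b x n - xbar n)) \<in> O(\<lambda>n. real n powr (- real N))"
    if "p1 = \<infinity> \<and> p2 = \<infinity> \<and> q = \<infinity>" for N
  proof -
    \<comment> \<open>The choice m = N + 2 meets m >= 2 also for N = 0 and gives the exponent - N -
      1.\<close>
    have "(\<lambda>n. max_norm (sample a b x n - xbar n)) \<in> O(\<lambda>n. real n powr (1 - real (N + 2)))"
      by (rule conv) (use that assms(2) in auto)
    also have "(\<lambda>n. real n powr (1 - real (N + 2))) \<in> O(\<lambda>n. real n powr (- real N))"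
    proof (rule bigoI[of _ 1])
      show "\<forall>\<^sub>F n in sequentially. norm (real n powr (1 - real (N + 2))) \<le> 1 * norm (real n powr (- real N))"
        using eventually_ge_at_top[of 1] by eventually_elim (auto intro!: powr_mono)
    qed
    finally show ?thesis .
  qed
qed

end
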